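(* Let $I$ be an index set, let $G_i$ $(i\in I)$ be groups, and let $F$ be a free group. Write $\varprojlim \ast G_i$ for the unrestricted free product of the $G_i$ $(i\in I)$. Then: (1) For each homomorphism $h:\varprojlim \ast G_i\to F$ there exist countably complete ultrafilters $u_0,\dots,u_m$ on $I$ such that $h = h\circ p_{U_0\cup\cdots\cup U_m}$ for every $U_0\in u_0,\dots,U_m\in u_m$, where for $S\subseteq I$ the map $p_S:\varprojlim\ast G_i\to\varprojlim\ast G_i$ is the canonical projection. (2) If the cardinality of the index set $I$ is less than the least measurable cardinal, then for each homomorphism $h:\varprojlim \ast G_i\to F$ there exist a finite subset $X_0$ of $I$ and a homomorphism $\overline{h}:\ast_{i\in X_0}G_i\to F$ such that $h=\overline{h}\circ p_{X_0}$, where here $p_{X_0}:\varprojlim\ast G_i\to\ast_{i\in X_0}G_i$ is the canonical projection onto the finite free product.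
   Context: For a finite subset $X$ of $I$, $\ast_{i\in X}G_i$ denotes the free product of the groups $G_i$ $(i\in X)$, with $\ast_{i\in\emptyset}G_i=\{e\}$. For finite $X\subseteq Y\subseteq I$, $p_{XY}:\ast_{i\in Y}G_i\to\ast_{i\in X}G_i$ is the canonical homomorphism (the identity on $G_i$ for $i\in X$, trivial on $G_i$ for $i\in Y\setminus X$). The unrestricted free product $\varprojlim\ast G_i$ is the inverse limit of the system $(\ast_{i\in X}G_i,\ p_{XY}: X\subseteq Y \text{ finite subsets of } I)$; its elements are families $x=(x(X))_{X}$, indexed by finite $X\subseteq I$, with $x(X)\in\ast_{i\in X}G_i$ and $p_{XY}(x(Y))=x(X)$ for $X\subseteq Y$. For an arbitrary $S\subseteq I$, the canonical projection $p_S:\varprojlim\ast G_i\to\varprojlim\ast G_i$ is defined by $p_S(x)(X)=x(X\cap S)$ for finite $X\subseteq I$, where $\ast_{i\in X\cap S}G_i$ is regarded as a subgroup of $\ast_{i\in X}G_i$. For finite $X_0\subseteq I$, the canonical projection $\varprojlim\ast G_i\to\ast_{i\in X_0}G_i$ is $x\mapsto x(X_0)$. An ultrafilter is countably complete if it is closed under countable intersections (principal ultrafilters are allowed). A measurable cardinal is an uncountable cardinal $\kappa$ carrying a nonprincipal $\kappa$-complete ultrafilter; if no measurable cardinal exists, the cardinality hypothesis in (2) is regarded as satisfied by every $I$. *)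

theory Defs
  imports "HOL-Algebra.Product_Groups" "HOL-Library.Countable_Set"
begin

unbundle cardinal_syntax


section \<open>Free products\<close>

text \<open>
  The free product of the \<open>G i\<close> with \<open>i \<in> X\<close> is realised on its normal forms: lists of letters
  \<open>(i, g)\<close> with \<open>i \<in> X\<close> and \<open>\<one> \<noteq> g \<in> G i\<close> in which adjacent letters have different indices.
  For \<open>X \<subseteq> Y\<close> the free product over \<open>X\<close> is then literally a subgroup of the one over \<open>Y\<close>.
\<close>

text \<open>Left multiplication of a normal form by a single letter (\<open>g = \<one>\<close> is allowed here).\<close>

fun fp_cons :: "('i \<Rightarrow> ('g, 'm) monoid_scheme) \<Rightarrow> 'i \<times> 'g \<Rightarrow> ('i \<times> 'g) list \<Rightarrow> ('i \<times> 'g) list" where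
  "fp_cons G (i, g) [] = (if g = \<one>\<^bsub>G i\<^esub> then [] else [(i, g)])"
| "fp_cons G (i, g) ((j, h) # w) =
     (if g = \<one>\<^bsub>G i\<^esub> then (j, h) # w
      else if i = j then (if g \<otimes>\<^bsub>G i\<^esub> h = \<one>\<^bsub>G i\<^esub> then w else (i, g \<otimes>\<^bsub>G i\<^esub> h) # w)
      else (i, g) # (j, h) # w)"

definition free_product ::
    "('i \<Rightarrow> ('g, 'm) monoid_scheme) \<Rightarrow> 'i set \<Rightarrow> ('i \<times> 'g) list monoid" where
  "free_product G X =
     \<lparr>carrier = {w. set w \<subseteq> (SIGMA i:X. carrier (G i) - {\<one>\<^bsub>G i\<^esub>})
                    \<and> successively (\<lambda>a b. fst a \<noteq> fst b) w},
      monoid.mult = (\<lambda>v w. foldr (fp_cons G) v w),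
      one = []\<rparr>"

text \<open>
  The canonical homomorphism onto the free product over \<open>X\<close>: delete the letters with index
  outside \<open>X\<close> and multiply the remaining ones. It serves as \<open>p\<^bsub>XY\<^esub>\<close> for every \<open>Y \<supseteq> X\<close>.
\<close>

definition fp_proj ::
    "('i \<Rightarrow> ('g, 'm) monoid_scheme) \<Rightarrow> 'i set \<Rightarrow> ('i \<times> 'g) list \<Rightarrow> ('i \<times> 'g) list" where
  "fp_proj G X w = foldr (fp_cons G) (filter (\<lambda>a. fst a \<in> X) w) []"


section \<open>The unrestricted free product\<close>

definition finite_subsets :: "'i set \<Rightarrow> 'i set set" where
  "finite_subsets I = {X. finite X \<and> X \<subseteq> I}"

definition unrestricted_free_product ::
    "('i \<Rightarrow> ('g, 'm) monoid_scheme) \<Rightarrow> 'i set \<Rightarrow> ('i set \<Rightarrow> ('i \<times> 'g) list) monoid" where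
  "unrestricted_free_product G I =
     (product_group (finite_subsets I) (free_product G))
       \<lparr>carrier := {x \<in> carrier (product_group (finite_subsets I) (free_product G)).
                     \<forall>X\<in>finite_subsets I. \<forall>Y\<in>finite_subsets I.
                       X \<subseteq> Y \<longrightarrow> fp_proj G X (x Y) = x X}\<rparr>"

definition ufp_proj ::
    "'i set \<Rightarrow> 'i set \<Rightarrow> ('i set \<Rightarrow> ('i \<times> 'g) list) \<Rightarrow> ('i set \<Rightarrow> ('i \<times> 'g) list)" where
  "ufp_proj I S x = (\<lambda>X\<in>finite_subsets I. x (X \<inter> S))"


section \<open>Free groups\<close>

text \<open>
  \<open>B\<close> is a free basis of \<open>F\<close> if every element of \<open>F\<close> is the value of exactly one reduced word in
  the letters \<open>b\<close> and \<open>b\<^sup>-\<^sup>1\<close> with \<open>b \<in> B\<close>. The letter \<open>(b, True)\<close> stands for \<open>b\<close> and \<open>(b, False)\<close>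
  for its inverse.
\<close>

definition reduced_words :: "'f set \<Rightarrow> ('f \<times> bool) list set" where
  "reduced_words B =
     {w \<in> lists (B \<times> UNIV). successively (\<lambda>a b. \<not> (fst a = fst b \<and> snd a \<noteq> snd b)) w}"

definition word_value :: "('f, 'm) monoid_scheme \<Rightarrow> ('f \<times> bool) list \<Rightarrow> 'f" where
  "word_value F w = foldr (\<lambda>(b, e) y. (if e then b else inv\<^bsub>F\<^esub> b) \<otimes>\<^bsub>F\<^esub> y) w \<one>\<^bsub>F\<^esub>"

definition free_basis :: "('f, 'm) monoid_scheme \<Rightarrow> 'f set \<Rightarrow> bool" where
  "free_basis F B \<longleftrightarrow>
     B \<subseteq> carrier F \<and> bij_betw (word_value F) (reduced_words B) (carrier F)"

definition free_group :: "('f, 'm) monoid_scheme \<Rightarrow> bool" where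
  "free_group F \<longleftrightarrow> group F \<and> (\<exists>B. free_basis F B)"


section \<open>Ultrafilters and measurable cardinals\<close>

definition ultrafilter_on :: "'i set \<Rightarrow> 'i set set \<Rightarrow> bool" where
  "ultrafilter_on I u \<longleftrightarrow>
     u \<subseteq> Pow I \<and> I \<in> u \<and> {} \<notin> u
     \<and> (\<forall>A\<in>u. \<forall>B. A \<subseteq> B \<and> B \<subseteq> I \<longrightarrow> B \<in> u)
     \<and> (\<forall>A\<in>u. \<forall>B\<in>u. A \<inter> B \<in> u)
     \<and> (\<forall>A. A \<subseteq> I \<longrightarrow> A \<in> u \<or> I - A \<in> u)"

definition countably_complete :: "'i set set \<Rightarrow> bool" where
  "countably_complete u \<longleftrightarrow> (\<forall>\<A>. \<A> \<subseteq> u \<and> \<A> \<noteq> {} \<and> countable \<A> \<longrightarrow> \<Inter>\<A> \<in> u)"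

definition principal_on :: "'i set \<Rightarrow> 'i set set \<Rightarrow> bool" where
  "principal_on I u \<longleftrightarrow> (\<exists>i\<in>I. u = {A. A \<subseteq> I \<and> i \<in> A})"

text \<open>Closure under intersections of fewer than \<open>r\<close> members, for a cardinal \<open>r\<close>.\<close>

definition card_complete :: "'k rel \<Rightarrow> 'i set set \<Rightarrow> bool" where
  "card_complete r u \<longleftrightarrow> (\<forall>\<A>. \<A> \<subseteq> u \<and> \<A> \<noteq> {} \<and> |\<A>| <o r \<longrightarrow> \<Inter>\<A> \<in> u)"

definition measurable_cardinal :: "'k rel \<Rightarrow> bool" where
  "measurable_cardinal r \<longleftrightarrow>
     Card_order r \<and> natLeq <o r
     \<and> (\<exists>u. ultrafilter_on (Field r) u \<and> \<not> principal_on (Field r) u \<and> card_complete r u)"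

text \<open>
  \<open>|I|\<close> is smaller than every measurable cardinal, hence smaller than the least one if there is one.
  Cardinals living on the type \<open>'i\<close> itself suffice: a measurable cardinal \<open>\<kappa> \<le> |I|\<close> is the
  cardinality of some subset of \<open>I\<close>, so it is isomorphic to a relation of type \<open>'i rel\<close>, and a
  measurable cardinal that is not isomorphic to one of these exceeds \<open>|I|\<close> anyway.
\<close>

definition below_least_measurable :: "'i set \<Rightarrow> bool" where
  "below_least_measurable I \<longleftrightarrow> (\<forall>r :: 'i rel. measurable_cardinal r \<longrightarrow> |I| <o r)"

end

theory Submission
  imports Defs
begin

text \<open>
  Call a sequence \<open>x n\<close> in the inverse limit null if every coordinate is eventually trivial. For a
  null sequence the equations \<open>y n = x n (y (n+1))\<^bsup>r n\<^esup>\<close> are solvable by infinite nested products,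
  whereas in a free group such a system has no solution when the \<open>x n\<close> are nontrivial and the \<open>r n\<close>
  exceed their lengths. Hence a homomorphism \<open>h\<close> to a free group kills a member of every null
  sequence.

  Let \<open>f\<close> be the filter of all \<open>S\<close> with \<open>h = h \<circ> p\<^sub>S\<close>. If \<open>S\<close> is the intersection of a decreasing
  sequence \<open>B n\<close> in \<open>f\<close>, then \<open>p\<^bsub>B n\<^esub> x\<close> and \<open>p\<^sub>S x\<close> differ by a null sequence, so \<open>f\<close> is countably
  complete. If the sets \<open>A n\<close> are disjoint, then \<open>x n\<close> and \<open>p\<^bsub>I - A n\<^esub> (x n)\<close> differ by a null
  sequence, so some \<open>I - A n\<close> is in \<open>f\<close>. A countably complete filter with the latter property is
  an intersection of finitely many countably complete ultrafilters. Below the least measurable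
  cardinal these are principal.
\<close>

subsection \<open>Length in free groups\<close>

text \<open>Formal inversion of a letter: a word is reduced when no letter is followed by its
  \<open>flip\<close>.\<close>

definition flip :: "'f \<times> bool \<Rightarrow> 'f \<times> bool" where
  "flip a = (fst a, \<not> snd a)"

lemma flip_flip [simp]: "flip (flip a) = a"
  by (simp add: flip_def)

lemma flip_neq [simp]: "flip a \<noteq> a" "a \<noteq> flip a"
  by (cases a; simp add: flip_def)+

text \<open>On a reduced word this gives the normal form of the product with one letter, so folding
  it over a word carries out the reduction.\<close>

fun red_cons :: "'f \<times> bool \<Rightarrow> ('f \<times> bool) list \<Rightarrow> ('f \<times> bool) list" where
  "red_cons a [] = [a]"
| "red_cons a (b # w) = (if b = flip a then w else a # b # w)"

lemma length_red_cons: "length (red_cons a w) \<le> Suc (length w)"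
  by (cases w) auto

lemma length_foldr_red_cons: "length (foldr red_cons v w) \<le> length v + length w"
  by (induction v) (auto intro: order_trans[OF length_red_cons])

lemma reduced_words_Nil: "[] \<in> reduced_words B"
  by (simp add: reduced_words_def)

lemma reduced_words_Cons:
  "a # w \<in> reduced_words B \<longleftrightarrow> fst a \<in> B \<and> w \<in> reduced_words B \<and> (w = [] \<or> hd w \<noteq> flip a)"
  by (cases a; cases "hd w") (auto simp: reduced_words_def successively_Cons flip_def)

lemma reduced_words_append:
  "v @ w \<in> reduced_words B \<longleftrightarrow>
     v \<in> reduced_words B \<and> w \<in> reduced_words B \<and> (v = [] \<or> w = [] \<or> hd w \<noteq> flip (last v))"
  by (cases "last v"; cases "hd w") (auto simp: reduced_words_def successively_append_iff flip_def)

text \<open>The inner factors \<open>inv x \<otimes> x\<close> cancel. This reduces powers of a word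
  to powers of its cyclically reduced core.\<close>

lemma (in group) conj_nat_pow:
  assumes "x \<in> carrier G" "y \<in> carrier G"
  shows "(x \<otimes> y \<otimes> inv x) [^] (n::nat) = x \<otimes> y [^] n \<otimes> inv x"
proof (induction n)
  case (Suc n)
  have "inv x \<otimes> (x \<otimes> (y \<otimes> inv x)) = y \<otimes> inv x"
    using assms by (simp flip: m_assoc)
  moreover have "(x \<otimes> y \<otimes> inv x) [^] Suc n = (x \<otimes> y [^] n \<otimes> inv x) \<otimes> (x \<otimes> y \<otimes> inv x)"
    by (simp only: nat_pow_Suc Suc)
  ultimately show ?case using assms by (simp add: m_assoc)
qed (use assms in auto)

locale free_group_basis = group F for F :: "('f, 'n) monoid_scheme" (structure) +
  fixes B
  assumes basis: "free_basis F B"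
begin

definition letter_value :: "'f \<times> bool \<Rightarrow> 'f" where
  "letter_value a = (if snd a then fst a else inv (fst a))"

lemma letter_value_closed: "fst a \<in> B \<Longrightarrow> letter_value a \<in> carrier F"
  using basis by (auto simp: free_basis_def letter_value_def)

lemma letter_value_flip: "fst a \<in> B \<Longrightarrow> letter_value (flip a) = inv (letter_value a)"
  using basis by (auto simp: free_basis_def letter_value_def flip_def)

lemma word_value_Nil: "word_value F [] = \<one>"
  by (simp add: word_value_def)

lemma word_value_Cons: "word_value F (a # w) = letter_value a \<otimes> word_value F w"
  by (cases a) (simp add: word_value_def letter_value_def)

lemma word_value_closed: "fst ` set w \<subseteq> B \<Longrightarrow> word_value F w \<in> carrier F"
  by (induction w) (auto simp: word_value_Nil word_value_Cons letter_value_closed)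

lemma reduced_words_letters: "w \<in> reduced_words B \<Longrightarrow> fst ` set w \<subseteq> B"
  by (auto simp: reduced_words_def)

lemma word_value_append:
  "fst ` set v \<subseteq> B \<Longrightarrow> fst ` set w \<subseteq> B \<Longrightarrow> word_value F (v @ w) = word_value F v \<otimes> word_value F w"
  by (induction v)
     (auto simp: word_value_Nil word_value_Cons letter_value_closed word_value_closed m_assoc)

lemma red_cons_reduced: "fst a \<in> B \<Longrightarrow> w \<in> reduced_words B \<Longrightarrow> red_cons a w \<in> reduced_words B"
  by (cases w) (auto simp: reduced_words_Cons reduced_words_Nil)

lemma word_value_red_cons:
  assumes "fst a \<in> B" "w \<in> reduced_words B"
  shows "word_value F (red_cons a w) = letter_value a \<otimes> word_value F w"
proof (cases "\<exists>v. w = flip a # v")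
  case True
  then obtain v where v: "w = flip a # v" by blast
  then have "word_value F v \<in> carrier F"
    using assms reduced_words_letters by (intro word_value_closed) fastforce
  then show ?thesis using assms
    by (simp add: v word_value_Cons letter_value_flip letter_value_closed flip: m_assoc)
next
  case False
  then show ?thesis by (cases w) (auto simp: word_value_Cons)
qed

text \<open>Induction along \<open>v\<close>, an arbitrary word over the basis. Together with
  \<open>length_foldr_red_cons\<close> it bounds the length of a product.\<close>

lemma foldr_red_cons:
  assumes "fst ` set v \<subseteq> B" "w \<in> reduced_words B"
  shows "foldr red_cons v w \<in> reduced_words B"
    and "word_value F (foldr red_cons v w) = word_value F v \<otimes> word_value F w"
proof -
  have w: "word_value F w \<in> carrier F"
    using assms by (intro word_value_closed reduced_words_letters)
  have "foldr red_cons v w \<in> reduced_words B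
     \<and> word_value F (foldr red_cons v w) = word_value F v \<otimes> word_value F w"
    using assms(1)
  proof (induction v)
    case (Cons a v)
    then show ?case using w
      by (simp add: red_cons_reduced word_value_red_cons word_value_Cons letter_value_closed
          word_value_closed m_assoc)
  qed (use assms w in \<open>auto simp: word_value_Nil\<close>)
  then show "foldr red_cons v w \<in> reduced_words B"
    and "word_value F (foldr red_cons v w) = word_value F v \<otimes> word_value F w" by auto
qed

lemma word_value_rev_flip:
  "fst ` set w \<subseteq> B \<Longrightarrow> word_value F (rev (map flip w)) = inv (word_value F w)"
proof (induction w)
  case (Cons a w)
  have "fst ` set (rev (map flip w)) \<subseteq> B" "fst ` set [flip a] \<subseteq> B"
    using Cons.prems by (auto simp: flip_def)
  then have "word_value F (rev (map flip (a # w)))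
      = word_value F (rev (map flip w)) \<otimes> word_value F [flip a]"
    by (simp only: list.map rev.simps word_value_append)
  then show ?case using Cons
    by (simp add: word_value_Cons word_value_Nil letter_value_flip letter_value_closed
        word_value_closed inv_mult_group)
qed (simp add: word_value_Nil)

lemma rev_flip_reduced: "w \<in> reduced_words B \<Longrightarrow> rev (map flip w) \<in> reduced_words B"
proof (induction w)
  case (Cons a w)
  then show ?case
    by (auto simp: reduced_words_Cons reduced_words_append reduced_words_Nil last_rev hd_map flip_def
        intro: prod_eqI)
qed (simp add: reduced_words_Nil)

section \<open>Word length of group elements\<close>

text \<open>For \<open>x\<close> in the carrier the chosen preimage is the normal form of
  \<open>x\<close>, since \<open>word_value\<close> is injective on reduced words.\<close>

definition len :: "'f \<Rightarrow> nat" where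
  "len x = length (inv_into (reduced_words B) (word_value F) x)"

lemma len_word_value: "w \<in> reduced_words B \<Longrightarrow> len (word_value F w) = length w"
  using basis by (auto simp: len_def free_basis_def bij_betw_def)

lemma ex_reduced_word: "x \<in> carrier F \<Longrightarrow> \<exists>w\<in>reduced_words B. word_value F w = x"
  using basis unfolding free_basis_def bij_betw_def by (metis imageE)

lemma len_one: "len \<one> = 0"
  using len_word_value[OF reduced_words_Nil] by (simp add: word_value_Nil)

lemma len_mult_le:
  assumes "x \<in> carrier F" "y \<in> carrier F"
  shows "len (x \<otimes> y) \<le> len x + len y"
proof -
  obtain v w where "v \<in> reduced_words B" "word_value F v = x" "w \<in> reduced_words B" "word_value F w = y"
    using assms ex_reduced_word by metis
  then show ?thesis
    using foldr_red_cons[OF reduced_words_letters, of v w] length_foldr_red_cons[of v w]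
    by (metis len_word_value)
qed

lemma len_inv:
  assumes "x \<in> carrier F"
  shows "len (inv x) = len x"
proof -
  obtain w where "w \<in> reduced_words B" "word_value F w = x"
    using assms ex_reduced_word by metis
  then show ?thesis
    using word_value_rev_flip[OF reduced_words_letters] rev_flip_reduced
    by (metis len_word_value length_map length_rev)
qed

section \<open>Lengths of powers\<close>

text \<open>Nothing cancels where two copies of \<open>w\<close> meet, so repeated concatenation
  stays reduced, and each copy adds at least one letter. The end letters are tracked to keep the
  induction going and for later conjugation.\<close>

lemma cyclically_reduced_power:
  assumes "w \<in> reduced_words B" "w \<noteq> []" "hd w \<noteq> flip (last w)"
  shows "\<exists>v\<in>reduced_words B. word_value F v = word_value F w [^] Suc n \<and> v \<noteq> [] \<and> hd v = hd w
    \<and> last v = last w \<and> length w + n \<le> length v"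
proof (induction n)
  case 0
  have "word_value F w \<in> carrier F" using assms by (intro word_value_closed reduced_words_letters)
  then show ?case using assms by (intro bexI[of _ w]) auto
next
  case (Suc n)
  then obtain v where v: "v \<in> reduced_words B" "word_value F v = word_value F w [^] Suc n" "v \<noteq> []"
    "hd v = hd w" "last v = last w" "length w + n \<le> length v" by blast
  have "word_value F (v @ w) = word_value F w [^] Suc (Suc n)"
    using v assms by (simp add: word_value_append reduced_words_letters)
  moreover have "v @ w \<in> reduced_words B" using v assms by (simp add: reduced_words_append)
  ultimately show ?case using v assms
    by (intro bexI[of _ "v @ w"]) (auto simp: Suc_le_eq length_greater_0_conv[of w, symmetric]
        simp del: length_greater_0_conv)
qed

text \<open>If the end letters of \<open>w\<close> are mutually inverse, then \<open>w\<close> is a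
  conjugate of a shorter word \<open>w'\<close> by a letter, and so is its power. The power of
  \<open>w'\<close> has the same end letters as \<open>w'\<close>, hence the conjugating letters do
  not cancel against it.\<close>

lemma reduced_power:
  assumes "w \<in> reduced_words B" "w \<noteq> []"
  shows "\<exists>v\<in>reduced_words B. word_value F v = word_value F w [^] Suc n \<and> v \<noteq> [] \<and> hd v = hd w
    \<and> last v = last w \<and> length w + n \<le> length v"
  using assms
proof (induction "length w" arbitrary: w rule: less_induct)
  case less
  show ?case
  proof (cases "hd w = flip (last w)")
    case False
    then show ?thesis using less cyclically_reduced_power by blast
  next
    case True
    obtain x u where xu: "w = x # u" using less.prems by (cases w) auto
    with True have "u \<noteq> []" by auto
    then obtain w' z where "u = w' @ [z]" by (metis rev_exhaust)
    with xu True have w: "w = x # w' @ [flip x]" by auto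
    \<comment> \<open>\<open>w'\<close> is nonempty because \<open>x\<close> followed by
      \<open>flip x\<close> would not be reduced.\<close>
    have w': "w' \<noteq> []" "w' \<in> reduced_words B" "fst x \<in> B" "hd w' \<noteq> flip x" "last w' \<noteq> x"
      using less.prems w
      by (auto simp: reduced_words_Cons reduced_words_append reduced_words_Nil hd_append split: if_splits)
    then obtain v where v: "v \<in> reduced_words B" "word_value F v = word_value F w' [^] Suc n" "v \<noteq> []"
      "hd v = hd w'" "last v = last w'" "length w' + n \<le> length v"
      using less.hyps[of w'] w by auto
    have conj: "word_value F (x # s @ [flip x]) = letter_value x \<otimes> word_value F s \<otimes> inv letter_value x"
      if "s \<in> reduced_words B" for s
      using that w'(3) reduced_words_letters[OF that]
      by (simp add: word_value_append word_value_Cons word_value_Nil letter_value_closed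
          word_value_closed letter_value_flip m_assoc flip_def[of x])
         (simp add: letter_value_flip flip: flip_def)
    have "flip x \<noteq> flip (last v)" using v w' by (metis flip_flip)
    have "word_value F (x # v @ [flip x]) = word_value F w [^] Suc n"
      unfolding w conj[OF w'(2)] conj[OF v(1)] v(2)
      using w' by (intro conj_nat_pow[symmetric])
        (auto intro!: letter_value_closed word_value_closed reduced_words_letters)
    moreover have "x # v @ [flip x] \<in> reduced_words B"
      using v w' \<open>flip x \<noteq> flip (last v)\<close>
      by (simp add: reduced_words_Cons reduced_words_append reduced_words_Nil) (simp add: flip_def)
    ultimately show ?thesis using v w by (intro bexI[of _ "x # v @ [flip x]"]) auto
  qed
qed

text \<open>Conjugation can make a power much shorter than the sum of the lengths of its factors,
  but every further factor still adds at least one letter.\<close>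

lemma len_pow_ge:
  assumes "x \<in> carrier F" "x \<noteq> \<one>"
  shows "len x + n \<le> len (x [^] Suc n)"
proof -
  obtain w where w: "w \<in> reduced_words B" "word_value F w = x"
    using assms ex_reduced_word by metis
  with assms have "w \<noteq> []" by (auto simp: word_value_Nil)
  from reduced_power[OF w(1) this] w show ?thesis
    by (metis len_word_value)
qed

text \<open>
  Since \<open>r n\<close> exceeds the length of \<open>a n\<close>, a solution \<open>y\<close> has strictly decreasing lengths.
\<close>

lemma ex_unsolvable_exponents:
  assumes a: "\<And>n. a n \<in> carrier F" "\<And>n. a n \<noteq> \<one>"
  shows "\<exists>r. \<forall>y. \<not> (\<forall>n::nat. y n \<in> carrier F \<and> y n = a n \<otimes> y (Suc n) [^] (r n :: nat))"
\<comment> \<open>With exponent \<open>len (a n) + 2\<close> a power of a nontrivial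
  \<open>y (Suc n)\<close> exceeds it in length by at least \<open>len (a n) + 1\<close>.
  Multiplying by \<open>a n\<close> can take back only \<open>len (a n)\<close> of this.\<close>
proof (intro exI[of _ "\<lambda>n. Suc (Suc (len (a n)))"] allI notI)
  fix y :: "nat \<Rightarrow> 'f"
  assume "\<forall>n. y n \<in> carrier F \<and> y n = a n \<otimes> y (Suc n) [^] Suc (Suc (len (a n)))"
  then have y: "y n \<in> carrier F" "y n = a n \<otimes> y (Suc n) [^] Suc (Suc (len (a n)))" for n
    by blast+
  have decr: "len (y (Suc n)) < len (y n)" if "y (Suc n) \<noteq> \<one>" for n
  proof -
    let ?p = "y (Suc n) [^] Suc (Suc (len (a n)))"
    have p: "?p \<in> carrier F" using y(1) by (intro nat_pow_closed)
    have "inv (a n) \<otimes> y n = inv (a n) \<otimes> (a n \<otimes> ?p)"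
      using y(2)[of n] by simp
    also have "\<dots> = ?p" using p a by (simp del: nat_pow_Suc flip: m_assoc)
    finally have "len ?p \<le> len (a n) + len (y n)"
      using len_mult_le[of "inv (a n)" "y n"] y(1)[of n] a(1)[of n] by (simp add: len_inv)
    then show ?thesis using len_pow_ge[OF y(1) that, of "Suc (len (a n))"] by linarith
  qed
  \<comment> \<open>If \<open>y (Suc n)\<close> were trivial, its equation and the nontriviality of
    \<open>a (Suc n)\<close> would make the next term nontrivial, yet of negative length by
    \<open>decr\<close>.\<close>
  have nontriv: "y (Suc n) \<noteq> \<one>" for n
  proof
    assume 1: "y (Suc n) = \<one>"
    have "y (Suc (Suc n)) \<noteq> \<one>"
      by (metis 1 a nat_pow_one r_one y(2))
    from decr[OF this] 1 show False by (simp add: len_one)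
  qed
  have "len (y n) + n \<le> len (y 0)" for n
  proof (induction n)
    case (Suc n)
    then show ?case using decr[OF nontriv, of n] by linarith
  qed simp
  from this[of "Suc (len (y 0))"] show False by linarith
qed

end

subsection \<open>Countably complete filters\<close>

text \<open>
  A set is decomposable if modulo the filter \<open>f\<close> it carries only finitely many ultrafilters. A
  non-decomposable set splits into a non-null part and a non-decomposable part; iterating this
  produces infinitely many disjoint non-null sets.
\<close>

lemma filter_contains_finite_Inter_ultrafilters:
  fixes I :: "'i set" and f :: "'i set set"
  assumes I: "I \<in> f"
    and up: "\<And>A B. A \<in> f \<Longrightarrow> A \<subseteq> B \<Longrightarrow> B \<subseteq> I \<Longrightarrow> B \<in> f"
    and Int: "\<And>A B. A \<in> f \<Longrightarrow> B \<in> f \<Longrightarrow> A \<inter> B \<in> f"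
    and cc: "countably_complete f"
    and disj: "\<And>A :: nat \<Rightarrow> 'i set. (\<And>n. A n \<subseteq> I) \<Longrightarrow> (\<And>m n. m < n \<Longrightarrow> A m \<inter> A n = {})
       \<Longrightarrow> \<exists>n. I - A n \<in> f"
  shows "\<exists>\<U>. finite \<U> \<and> (\<forall>u\<in>\<U>. ultrafilter_on I u \<and> countably_complete u)
    \<and> (\<forall>S\<subseteq>I. (\<forall>u\<in>\<U>. S \<in> u) \<longrightarrow> S \<in> f)"
proof -
  \<comment> \<open>The condition \<open>S \<union> (I - A) \<in> f\<close> says that
    \<open>S\<close> contains \<open>A\<close> modulo \<open>f\<close>. The empty family of
    ultrafilters is allowed, so null sets are decomposable.\<close>
  define dec where "dec A \<longleftrightarrow> (\<exists>\<U>. finite \<U> \<and> (\<forall>u\<in>\<U>. ultrafilter_on I u \<and> countably_complete u)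
    \<and> (\<forall>S\<subseteq>I. (\<forall>u\<in>\<U>. S \<in> u) \<longrightarrow> S \<union> (I - A) \<in> f))" for A
  have null: "dec A" if "I - A \<in> f" for A
    unfolding dec_def by (intro exI[of _ "{}"]) (auto intro: up[OF that])
  have union: "dec (A \<union> B)" if "dec A" "dec B" for A B
  proof -
    obtain \<U> where
      U: "finite \<U>" "\<forall>u\<in>\<U>. ultrafilter_on I u \<and> countably_complete u"
        "\<forall>S\<subseteq>I. (\<forall>u\<in>\<U>. S \<in> u) \<longrightarrow> S \<union> (I - A) \<in> f"
      using \<open>dec A\<close> unfolding dec_def by blast
    obtain \<V> where
      V: "finite \<V>" "\<forall>u\<in>\<V>. ultrafilter_on I u \<and> countably_complete u"
        "\<forall>S\<subseteq>I. (\<forall>u\<in>\<V>. S \<in> u) \<longrightarrow> S \<union> (I - B) \<in> f"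
      using \<open>dec B\<close> unfolding dec_def by blast
    have "S \<union> (I - (A \<union> B)) \<in> f" if "S \<subseteq> I" "\<forall>u\<in>\<U> \<union> \<V>. S \<in> u" for S
    proof -
      have "(S \<union> (I - A)) \<inter> (S \<union> (I - B)) \<in> f" using U V that by (intro Int) auto
      then show ?thesis by (rule up) (use that in auto)
    qed
    then show ?thesis unfolding dec_def
      by (intro exI[of _ "\<U> \<union> \<V>"]) (use U V in auto)
  qed
  have atom: "dec A"
    if "A \<subseteq> I" "I - A \<notin> f" and split: "\<And>B. B \<subseteq> A \<Longrightarrow> I - B \<in> f \<or> I - (A - B) \<in> f" for A
  proof -
    \<comment> \<open>The trace of \<open>f\<close> on \<open>A\<close>. It is an ultrafilter
      because \<open>A\<close> is not null and has no splitting into two non-null parts; it inherits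
      countable completeness because adjoining \<open>I - A\<close> commutes with
      intersections.\<close>
    define u where "u = {S. S \<subseteq> I \<and> S \<union> (I - A) \<in> f}"
    have "ultrafilter_on I u"
      unfolding ultrafilter_on_def
    proof (intro conjI ballI allI impI)
      show "S \<inter> T \<in> u" if "S \<in> u" "T \<in> u" for S T
      proof -
        have "(S \<union> (I - A)) \<inter> (T \<union> (I - A)) \<in> f" using that by (intro Int) (auto simp: u_def)
        then have "(S \<inter> T) \<union> (I - A) \<in> f" by (rule up) (use that in \<open>auto simp: u_def\<close>)
        with that show ?thesis by (auto simp: u_def)
      qed
      show "S \<in> u \<or> I - S \<in> u" if "S \<subseteq> I" for S
      proof -
        have "I - (A - S) = S \<union> (I - A)" "I - (A - (A - S)) = (I - S) \<union> (I - A)"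
          using \<open>A \<subseteq> I\<close> that by auto
        with split[of "A - S"] that show ?thesis by (auto simp: u_def)
      qed
      show "T \<in> u" if "S \<in> u" "S \<subseteq> T \<and> T \<subseteq> I" for S T
        using that up[of "S \<union> (I - A)" "T \<union> (I - A)"] unfolding u_def by blast
    qed (use that(1,2) I in \<open>auto simp: u_def Un_absorb2\<close>)
    moreover have "countably_complete u"
      unfolding countably_complete_def
    proof (intro allI impI)
      fix \<A> assume \<A>: "\<A> \<subseteq> u \<and> \<A> \<noteq> {} \<and> countable \<A>"
      then have "\<Inter>((\<lambda>S. S \<union> (I - A)) ` \<A>) \<in> f"
        using cc[unfolded countably_complete_def, rule_format, of "(\<lambda>S. S \<union> (I - A)) ` \<A>"]
        by (auto simp: u_def)
      moreover have "\<Inter>((\<lambda>S. S \<union> (I - A)) ` \<A>) = \<Inter>\<A> \<union> (I - A)" by blast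
      moreover have "\<Inter>\<A> \<subseteq> I" using \<A> by (auto simp: u_def)
      ultimately show "\<Inter>\<A> \<in> u" by (simp add: u_def)
    qed
    ultimately show ?thesis unfolding dec_def
      by (intro exI[of _ "{u}"]) (auto simp: u_def)
  qed
  have "dec I"
  proof (rule ccontr)
    assume "\<not> dec I"
    have "\<exists>A :: nat \<Rightarrow> 'i set. \<forall>n. (A n \<subseteq> I \<and> \<not> dec (A n)) \<and> (A (Suc n) \<subseteq> A n \<and> I - (A n - A (Suc n)) \<notin> f)"
    proof (rule dependent_nat_choice)
      show "\<exists>A. A \<subseteq> I \<and> \<not> dec A" using \<open>\<not> dec I\<close> by blast
      show "\<exists>B. (B \<subseteq> I \<and> \<not> dec B) \<and> B \<subseteq> A \<and> I - (A - B) \<notin> f" if "A \<subseteq> I \<and> \<not> dec A" for A and n :: nat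
      proof -
        \<comment> \<open>\<open>A\<close> is neither null nor an atom, so it splits into two
          non-null parts. By \<open>union\<close> one of them is not decomposable; that one is kept
          and the other is the non-null difference.\<close>
        have "\<not> (\<forall>B\<subseteq>A. I - B \<in> f \<or> I - (A - B) \<in> f)"
          using atom[of A] null[of A] that by auto
        then obtain B where B: "B \<subseteq> A" "I - B \<notin> f" "I - (A - B) \<notin> f" by blast
        have "A - (A - B) = B" "B \<union> (A - B) = A" using B by auto
        then show ?thesis using union[of B "A - B"] that B
          by (metis Diff_subset order_trans)
      qed
    qed
    then obtain A where A: "\<And>n. A n \<subseteq> I" "\<And>n. A (Suc n) \<subseteq> A n" "\<And>n. I - (A n - A (Suc n)) \<notin> f"
      by blast
    \<comment> \<open>This makes the successive differences disjoint, so that \<open>disj\<close>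
      applies to them.\<close>
    have "A n \<subseteq> A (Suc m)" if "m < n" for m n
      using lift_Suc_antimono_le[of A "Suc m" n] A(2) that by simp
    then have "\<exists>n. I - (A n - A (Suc n)) \<in> f"
      using A(1) by (intro disj) blast+
    with A(3) show False by blast
  qed
  then obtain \<U> where "finite \<U>" "\<forall>u\<in>\<U>. ultrafilter_on I u \<and> countably_complete u"
    "\<forall>S\<subseteq>I. (\<forall>u\<in>\<U>. S \<in> u) \<longrightarrow> S \<union> (I - I) \<in> f" unfolding dec_def by blast
  then show ?thesis by (intro exI[of _ \<U>]) auto
qed

section \<open>Ultrafilters and principality below the measurable cardinals\<close>

lemma ultrafilter_onD:
  assumes "ultrafilter_on I u"
  shows "I \<in> u" "{} \<notin> u" "A \<in> u \<Longrightarrow> A \<subseteq> I"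
    "A \<in> u \<Longrightarrow> A \<subseteq> B \<Longrightarrow> B \<subseteq> I \<Longrightarrow> B \<in> u"
    "A \<in> u \<Longrightarrow> B \<in> u \<Longrightarrow> A \<inter> B \<in> u"
  using assms unfolding ultrafilter_on_def by simp_all blast+

lemma ultrafilter_on_Compl:
  assumes "ultrafilter_on I u" "A \<subseteq> I"
  shows "I - A \<in> u \<longleftrightarrow> A \<notin> u"
proof
  assume *: "I - A \<in> u"
  show "A \<notin> u"
  proof
    assume "A \<in> u"
    from ultrafilter_onD(5)[OF assms(1) this *] ultrafilter_onD(2)[OF assms(1)] show False by simp
  qed
qed (use assms in \<open>simp add: ultrafilter_on_def, blast\<close>)

lemma principal_onI:
  assumes "ultrafilter_on I u" "{i} \<in> u"
  shows "principal_on I u"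
proof -
  note u = ultrafilter_onD[OF assms(1)]
  have i: "i \<in> I" using u(3)[OF assms(2)] by simp
  have "A \<in> u \<longleftrightarrow> i \<in> A" if "A \<subseteq> I" for A
  proof
    assume "A \<in> u"
    from u(5)[OF this assms(2)] u(2) show "i \<in> A" by (cases "i \<in> A") simp_all
  next
    assume "i \<in> A"
    then show "A \<in> u" using u(4)[OF assms(2)] that by simp
  qed
  with u(3) have "u = {A. A \<subseteq> I \<and> i \<in> A}" by blast
  with i show ?thesis unfolding principal_on_def by blast
qed

lemma principal_ultrafilter:
  assumes "i \<in> I"
  shows "ultrafilter_on I {A. A \<subseteq> I \<and> i \<in> A}" "countably_complete {A. A \<subseteq> I \<and> i \<in> A}"
  using assms by (auto simp: ultrafilter_on_def countably_complete_def)

text \<open>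
  Among the maps \<open>g : I \<rightarrow> J \<subseteq> I\<close> all of whose fibres are null, one with \<open>J\<close> of least cardinality
  pushes \<open>u\<close> forward to a \<open>|J|\<close>-complete ultrafilter: a family of fewer than \<open>|J|\<close> large sets
  with small intersection would give such a map into a smaller set.
\<close>

lemma countably_complete_imp_principal:
  fixes I :: "'i set"
  assumes u: "ultrafilter_on I u" and cc: "countably_complete u" and below: "below_least_measurable I"
  shows "principal_on I u"
proof (rule ccontr)
  assume np: "\<not> principal_on I u"
  note up = ultrafilter_onD(4)[OF u] and Int = ultrafilter_onD(5)[OF u]
  have compl: "I - A \<in> u \<longleftrightarrow> A \<notin> u" if "A \<subseteq> I" for A using ultrafilter_on_Compl[OF u that] .
  have empty: "{} \<notin> u" and Iu: "I \<in> u" using ultrafilter_onD[OF u] by auto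
  define nullmap where "nullmap g J \<longleftrightarrow> g ` I \<subseteq> J \<and> (\<forall>j\<in>J. {i\<in>I. g i = j} \<notin> u)" for g and J :: "'i set"
  \<comment> \<open>Only subsets of \<open>I\<close> compete, so all cardinals here live on the type
    of \<open>I\<close>, as in \<open>below_least_measurable\<close>. The identity is a candidate
    because \<open>u\<close> is nonprincipal, and well-foundedness of \<open><o\<close> provides a
    minimum.\<close>
  define \<R> where "\<R> = {|J| | J. J \<subseteq> I \<and> (\<exists>g. nullmap g J)}"
  have "{i \<in> I. id i = j} \<notin> u" if "j \<in> I" for j
  proof -
    have "{i \<in> I. id i = j} = {j}" using that by auto
    then show ?thesis using principal_onI[OF u] np by metis
  qed
  then have "nullmap id I" by (auto simp: nullmap_def)
  then have "|I| \<in> \<R>" unfolding \<R>_def by blast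
  then obtain r where r: "r \<in> \<R>" "\<And>s. s \<in> \<R> \<Longrightarrow> \<not> s <o r"
    using wf_ordLess unfolding wf_eq_minimal by metis
  then obtain J g where r_eq: "r = |J|" and JI: "J \<subseteq> I" and g: "nullmap g J"
    unfolding \<R>_def by blast
  have gJ: "g i \<in> J" if "i \<in> I" for i using g that by (auto simp: nullmap_def)
  have minimal: "\<not> |K| <o |J|" if "K \<subseteq> I" "nullmap k K" for k K
  proof -
    have "|K| \<in> \<R>" using that unfolding \<R>_def by blast
    then show ?thesis using r(2) r_eq by simp
  qed
  define v where "v = {B. B \<subseteq> J \<and> {i\<in>I. g i \<in> B} \<in> u}"
  have fib: "{i\<in>I. g i \<in> J} = I" using gJ by blast
  have v: "ultrafilter_on J v"
    unfolding ultrafilter_on_def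
  proof (intro conjI ballI allI impI)
    show "A \<inter> B \<in> v" if "A \<in> v" "B \<in> v" for A B
    proof -
      have "{i\<in>I. g i \<in> A \<inter> B} = {i\<in>I. g i \<in> A} \<inter> {i\<in>I. g i \<in> B}" by blast
      then show ?thesis using that Int unfolding v_def by auto
    qed
    show "A \<in> v \<or> J - A \<in> v" if "A \<subseteq> J" for A
    proof -
      have "{i\<in>I. g i \<in> J - A} = I - {i\<in>I. g i \<in> A}" using gJ by blast
      then show ?thesis using that compl[of "{i\<in>I. g i \<in> A}"] unfolding v_def by auto
    qed
    show "B \<in> v" if "A \<in> v" "A \<subseteq> B \<and> B \<subseteq> J" for A B
      using that up[of "{i\<in>I. g i \<in> A}" "{i\<in>I. g i \<in> B}"] unfolding v_def by blast
  qed (use fib Iu empty in \<open>auto simp: v_def\<close>)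
  have "\<not> principal_on J v"
  proof
    assume "principal_on J v"
    then obtain j where "j \<in> J" "v = {A. A \<subseteq> J \<and> j \<in> A}" unfolding principal_on_def by blast
    then have "{j} \<in> v" by auto
    then show False using g \<open>j \<in> J\<close> by (auto simp: v_def nullmap_def)
  qed
  \<comment> \<open>For countable \<open>J\<close> the complements of the fibres would be countably
    many large sets with empty intersection.\<close>
  moreover have "natLeq <o |J|"
  proof (rule ccontr)
    assume "\<not> natLeq <o |J|"
    then have "|J| \<le>o natLeq"
      using not_ordLess_iff_ordLeq[OF card_of_Well_order natLeq_Well_order] by blast
    then have "|J| \<le>o |UNIV :: nat set|"
      using card_of_nat ordIso_symmetric ordLeq_ordIso_trans by blast
    then have "countable J" unfolding countable_def card_of_ordLeq[symmetric] by blast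
    then have "countable ((\<lambda>j. I - {i\<in>I. g i = j}) ` J)" by simp
    moreover have "(\<lambda>j. I - {i\<in>I. g i = j}) ` J \<subseteq> u"
      using g compl by (auto simp: nullmap_def)
    moreover have "J \<noteq> {}" using fib Iu empty by auto
    ultimately have "(\<Inter>j\<in>J. I - {i\<in>I. g i = j}) \<in> u"
      using cc[unfolded countably_complete_def, rule_format, of "(\<lambda>j. I - {i\<in>I. g i = j}) ` J"]
      by simp
    moreover have "(\<Inter>j\<in>J. I - {i\<in>I. g i = j}) = {}" using gJ \<open>J \<noteq> {}\<close> by blast
    ultimately show False using empty by simp
  qed
  moreover have "card_complete (card_of J) v"
    unfolding card_complete_def
  proof (intro allI impI, elim conjE)
    fix \<B> assume \<B>: "\<B> \<subseteq> v" "\<B> \<noteq> {}" "|\<B>| <o |J|"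
    show "\<Inter>\<B> \<in> v"
    proof (rule ccontr)
      assume not: "\<Inter>\<B> \<notin> v"
      obtain e where e: "inj_on e \<B>" "e ` \<B> \<subseteq> J"
        using \<B>(3) card_of_ordLeq[of \<B> J] ordLess_imp_ordLeq by blast
      obtain B0 where B0: "B0 \<in> \<B>" using \<B> by blast
      \<comment> \<open>\<open>k\<close> sends \<open>i\<close> to the code of some member of
        \<open>\<B>\<close> that omits \<open>g i\<close>. The default value \<open>e B0\<close>
        serves the points with \<open>g i \<in> \<Inter>\<B>\<close>, which form a null set.\<close>
      define k where "k i = (if g i \<in> \<Inter>\<B> then e B0 else e (SOME B. B \<in> \<B> \<and> g i \<notin> B))" for i
      have some: "(SOME B. B \<in> \<B> \<and> g i \<notin> B) \<in> \<B> \<and> g i \<notin> (SOME B. B \<in> \<B> \<and> g i \<notin> B)"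
        if "g i \<notin> \<Inter>\<B>" for i
      proof -
        have "\<exists>B. B \<in> \<B> \<and> g i \<notin> B" using that by blast
        then show ?thesis by (rule someI_ex)
      qed
      \<comment> \<open>Apart from the null set where the default may occur, the fibre over
        \<open>e B\<close> misses the large set of points with \<open>g i \<in> B\<close>.\<close>
      have "{i\<in>I. k i = e B} \<notin> u" if B: "B \<in> \<B>" for B
      proof
        assume "{i\<in>I. k i = e B} \<in> u"
        moreover have "{i\<in>I. g i \<in> B} \<in> u" using B \<B> by (auto simp: v_def)
        moreover have "I - {i\<in>I. g i \<in> \<Inter>\<B>} \<in> u"
        proof -
          have "\<Inter>\<B> \<subseteq> J" using B0 \<B> by (auto simp: v_def)
          then show ?thesis using not compl[of "{i\<in>I. g i \<in> \<Inter>\<B>}"] by (auto simp: v_def)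
        qed
        ultimately have "{i\<in>I. k i = e B} \<inter> ({i\<in>I. g i \<in> B} \<inter> (I - {i\<in>I. g i \<in> \<Inter>\<B>})) \<in> u"
          by (intro Int)
        moreover have "{i\<in>I. k i = e B} \<inter> ({i\<in>I. g i \<in> B} \<inter> (I - {i\<in>I. g i \<in> \<Inter>\<B>})) = {}"
        proof (rule equals0I)
          fix i assume "i \<in> {i\<in>I. k i = e B} \<inter> ({i\<in>I. g i \<in> B} \<inter> (I - {i\<in>I. g i \<in> \<Inter>\<B>}))"
          then have i: "k i = e B" "g i \<in> B" "g i \<notin> \<Inter>\<B>" by auto
          then have "(SOME B. B \<in> \<B> \<and> g i \<notin> B) = B"
            using some[OF i(3)] e(1) B by (simp only: k_def if_False) (blast dest: inj_onD)
          with some[OF i(3)] i(2) show False by simp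
        qed
        ultimately show False using empty by simp
      qed
      moreover have "k i \<in> e ` \<B>" for i
        using some[of i] B0 unfolding k_def by (cases "g i \<in> \<Inter>\<B>") auto
      ultimately have "nullmap k (e ` \<B>)"
        unfolding nullmap_def by blast
      moreover have "e ` \<B> \<subseteq> I" using e JI by blast
      moreover have "|e ` \<B>| <o |J|"
        using card_of_image[of e \<B>] \<B>(3) by (rule ordLeq_ordLess_trans)
      ultimately show False using minimal by blast
    qed
  qed
  ultimately have "measurable_cardinal |J|"
    using v card_of_card_order_on unfolding measurable_cardinal_def Field_card_of by blast
  then have "|I| <o |J|" using below unfolding below_least_measurable_def by blast
  then show False using card_of_mono1[OF JI] not_ordLess_ordLeq by blast
qed

subsection \<open>Free products\<close>

text \<open>
  Every normal form is \<open>fp_glue G i k t\<close> for a \<open>t\<close> not starting with the index \<open>i\<close>; in this shape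
  \<open>fp_cons G (i, g)\<close> is left multiplication of \<open>k\<close> by \<open>g\<close>, and the case distinctions disappear.
\<close>

definition fp_glue :: "('i \<Rightarrow> ('g, 'm) monoid_scheme) \<Rightarrow> 'i \<Rightarrow> 'g \<Rightarrow> ('i \<times> 'g) list \<Rightarrow> ('i \<times> 'g) list" where
  "fp_glue G i g w = (if g = \<one>\<^bsub>G i\<^esub> then w else (i, g) # w)"

locale group_family =
  fixes G :: "'i \<Rightarrow> ('g, 'm) monoid_scheme" and I :: "'i set"
  assumes group_G: "i \<in> I \<Longrightarrow> group (G i)"
begin

abbreviation words :: "'i set \<Rightarrow> ('i \<times> 'g) list set" where
  "words X \<equiv> carrier (free_product G X)"

lemma words_Nil: "[] \<in> words X"
  by (simp add: free_product_def)

lemma words_Cons: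
  "(i, g) # w \<in> words X \<longleftrightarrow>
     i \<in> X \<and> g \<in> carrier (G i) \<and> g \<noteq> \<one>\<^bsub>G i\<^esub> \<and> w \<in> words X \<and> (w = [] \<or> fst (hd w) \<noteq> i)"
  by (auto simp: free_product_def successively_Cons)

lemma words_mono: "X \<subseteq> Y \<Longrightarrow> words X \<subseteq> words Y"
  by (fastforce simp: free_product_def)

lemma words_split:
  assumes "w \<in> words X" "X \<subseteq> I" "i \<in> I"
  obtains k t where "k \<in> carrier (G i)" "t \<in> words X" "t = [] \<or> fst (hd t) \<noteq> i"
    "w = fp_glue G i k t"
proof -
  interpret group "G i" by (rule group_G) fact
  consider "w = [] \<or> fst (hd w) \<noteq> i" | k t where "w = (i, k) # t"
    by (metis list.collapse prod.collapse)
  then show thesis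
  proof cases
    case 1
    then show thesis by (intro that[of "\<one>\<^bsub>G i\<^esub>" w]) (auto simp: fp_glue_def assms)
  next
    case 2
    then show thesis using assms by (intro that[of k t]) (auto simp: fp_glue_def words_Cons)
  qed
qed

lemma fp_glue_in_words:
  assumes "i \<in> X" "k \<in> carrier (G i)" "t \<in> words X" "t = [] \<or> fst (hd t) \<noteq> i"
  shows "fp_glue G i k t \<in> words X"
  using assms by (simp add: fp_glue_def words_Cons)

lemma fp_cons_glue:
  assumes "i \<in> I" "g \<in> carrier (G i)" "k \<in> carrier (G i)" "t = [] \<or> fst (hd t) \<noteq> i"
  shows "fp_cons G (i, g) (fp_glue G i k t) = fp_glue G i (g \<otimes>\<^bsub>G i\<^esub> k) t"
proof -
  interpret group "G i" by (rule group_G) fact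
  show ?thesis using assms
    by (cases t) (auto simp: fp_glue_def)
qed

lemma fp_cons_in_words:
  assumes "X \<subseteq> I" "i \<in> X" "g \<in> carrier (G i)" "w \<in> words X"
  shows "fp_cons G (i, g) w \<in> words X"
proof -
  have i: "i \<in> I" using assms by auto
  interpret group "G i" by (rule group_G) fact
  obtain k t where *: "k \<in> carrier (G i)" "t \<in> words X" "t = [] \<or> fst (hd t) \<noteq> i"
    "w = fp_glue G i k t" using words_split[OF assms(4,1) i] by blast
  show ?thesis unfolding *(4) fp_cons_glue[OF i assms(3) *(1,3)]
    by (rule fp_glue_in_words) (use * assms in auto)
qed

text \<open>Together with \<open>fp_cons_one\<close> this says that each \<open>G i\<close> acts on
  the normal forms. As in van der Waerden's argument, associativity of the free product is derived
  from these actions.\<close>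

lemma fp_cons_fp_cons:
  assumes "X \<subseteq> I" "i \<in> I" "g \<in> carrier (G i)" "h \<in> carrier (G i)" "w \<in> words X"
  shows "fp_cons G (i, g) (fp_cons G (i, h) w) = fp_cons G (i, g \<otimes>\<^bsub>G i\<^esub> h) w"
proof -
  interpret group "G i" by (rule group_G) fact
  obtain k t where *: "k \<in> carrier (G i)" "t \<in> words X" "t = [] \<or> fst (hd t) \<noteq> i"
    "w = fp_glue G i k t" using words_split[OF assms(5,1,2)] by blast
  show ?thesis unfolding *(4) using * assms by (simp add: fp_cons_glue m_assoc)
qed

lemma fp_cons_one: "fp_cons G (i, \<one>\<^bsub>G i\<^esub>) w = w"
  by (cases w) auto

lemma fp_cons_eq_Cons:
  assumes "(i, g) # w \<in> words X"
  shows "fp_cons G (i, g) w = (i, g) # w"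
  using assms by (cases w) (auto simp: words_Cons)

section \<open>The group law on normal forms\<close>

text \<open>Identity elements are included and lists over \<open>letters\<close> may repeat an
  index, so unreduced words such as filtered normal forms are covered.\<close>

definition letters :: "'i set \<Rightarrow> ('i \<times> 'g) set" where
  "letters X = (SIGMA i:X. carrier (G i))"

lemma words_letters: "w \<in> words X \<Longrightarrow> set w \<subseteq> letters X"
  by (auto simp: free_product_def letters_def)

lemma foldr_fp_cons_in_words:
  assumes "X \<subseteq> I" "set v \<subseteq> letters X" "w \<in> words X"
  shows "foldr (fp_cons G) v w \<in> words X"
  using assms(2)
proof (induction v)
  case (Cons a v)
  then show ?case
    by (cases a) (auto simp: letters_def intro!: fp_cons_in_words assms(1))
qed (use assms in auto)

lemma foldr_fp_cons_Nil: "w \<in> words X \<Longrightarrow> foldr (fp_cons G) w [] = w"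
  by (induction w) (auto simp: words_Cons fp_cons_eq_Cons[where X = X])

lemma foldr_fp_cons_fp_cons:
  assumes "X \<subseteq> I" "i \<in> X" "g \<in> carrier (G i)" "v \<in> words X" "w \<in> words X"
  shows "foldr (fp_cons G) (fp_cons G (i, g) v) w = fp_cons G (i, g) (foldr (fp_cons G) v w)"
proof -
  have i: "i \<in> I" using assms by auto
  interpret group "G i" by (rule group_G) fact
  have glue: "foldr (fp_cons G) (fp_glue G i k t) w = fp_cons G (i, k) (foldr (fp_cons G) t w)" for k t
    by (simp add: fp_glue_def fp_cons_one)
  obtain k t where *: "k \<in> carrier (G i)" "t \<in> words X" "t = [] \<or> fst (hd t) \<noteq> i"
    "v = fp_glue G i k t" using words_split[OF assms(4,1) i] by blast
  have "foldr (fp_cons G) t w \<in> words X"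
    using * assms by (intro foldr_fp_cons_in_words words_letters)
  then show ?thesis using assms * i
    by (simp add: fp_cons_glue glue fp_cons_fp_cons[where X = X])
qed

text \<open>Associativity, by peeling letters off \<open>u\<close>. It is stated for unreduced
  \<open>u\<close> because projections fold over filtered lists.\<close>

lemma foldr_fp_cons_foldr:
  assumes "X \<subseteq> I" "set u \<subseteq> letters X" "v \<in> words X" "w \<in> words X"
  shows "foldr (fp_cons G) (foldr (fp_cons G) u v) w = foldr (fp_cons G) u (foldr (fp_cons G) v w)"
  using assms(2)
proof (induction u)
  case (Cons a u)
  obtain i g where a: "a = (i, g)" by (cases a)
  have "foldr (fp_cons G) u v \<in> words X"
    using Cons assms by (intro foldr_fp_cons_in_words) auto
  then show ?case using Cons assms by (simp add: a letters_def foldr_fp_cons_fp_cons[where X = X])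
qed auto

lemma mult_free_product: "v \<otimes>\<^bsub>free_product G X\<^esub> w = foldr (fp_cons G) v w"
  and one_free_product: "\<one>\<^bsub>free_product G X\<^esub> = []"
  by (simp_all add: free_product_def)

text \<open>A left inverse of the tail, multiplied on the right by the inverse of the first letter,
  is a left inverse of the whole word.\<close>

lemma ex_left_inverse_word:
  assumes "X \<subseteq> I" "w \<in> words X"
  shows "\<exists>v\<in>words X. foldr (fp_cons G) v w = []"
  using assms(2)
proof (induction w)
  case (Cons a w)
  obtain i g where a: "a = (i, g)" by (cases a)
  have w: "i \<in> X" "i \<in> I" "g \<in> carrier (G i)" "w \<in> words X" using Cons assms by (auto simp: a words_Cons)
  interpret group "G i" by (rule group_G) (use w in auto)
  obtain v where v: "v \<in> words X" "foldr (fp_cons G) v w = []" using Cons w by auto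
  let ?b = "(i, inv\<^bsub>G i\<^esub> g)"
  let ?v = "foldr (fp_cons G) v (fp_cons G ?b [])"
  have b: "fp_cons G ?b [] \<in> words X"
    using w assms by (intro fp_cons_in_words words_Nil) auto
  have "foldr (fp_cons G) (fp_cons G ?b []) (a # w) = fp_cons G ?b (a # w)"
    using foldr_fp_cons_fp_cons[of X i "inv\<^bsub>G i\<^esub> g" "[]" "a # w"] assms w Cons.prems words_Nil by simp
  also have "\<dots> = fp_cons G ?b (fp_cons G (i, g) w)"
    using fp_cons_eq_Cons Cons.prems a by metis
  also have "\<dots> = w"
    using w assms by (subst fp_cons_fp_cons[where X = X]) (auto simp: fp_cons_one)
  finally have "foldr (fp_cons G) (fp_cons G ?b []) (a # w) = w" .
  then have "foldr (fp_cons G) ?v (a # w) = []"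
    using foldr_fp_cons_foldr[OF assms(1) words_letters[OF v(1)] b Cons.prems] v by simp
  moreover have "?v \<in> words X" using assms v b by (intro foldr_fp_cons_in_words words_letters)
  ultimately show ?case by blast
qed (auto intro!: bexI[of _ "[]"] words_Nil)

lemma group_free_product:
  assumes "X \<subseteq> I"
  shows "group (free_product G X)"
proof (rule groupI)
  fix u v w assume uvw: "u \<in> words X" "v \<in> words X" "w \<in> words X"
  show "u \<otimes>\<^bsub>free_product G X\<^esub> v \<otimes>\<^bsub>free_product G X\<^esub> w
      = u \<otimes>\<^bsub>free_product G X\<^esub> (v \<otimes>\<^bsub>free_product G X\<^esub> w)"
    unfolding mult_free_product using uvw assms by (intro foldr_fp_cons_foldr words_letters)
qed (use assms in \<open>auto simp: mult_free_product one_free_product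
       intro!: foldr_fp_cons_in_words words_letters words_Nil ex_left_inverse_word\<close>)

section \<open>Canonical projections between free products\<close>

lemma fp_proj_in_words:
  assumes "X \<subseteq> I" "w \<in> words Y"
  shows "fp_proj G X w \<in> words X"
  unfolding fp_proj_def using assms words_letters[OF assms(2)]
  by (intro foldr_fp_cons_in_words words_Nil) (auto simp: letters_def)

lemma fp_proj_eq_self: "w \<in> words X \<Longrightarrow> X \<subseteq> Y \<Longrightarrow> fp_proj G Y w = w"
  using words_letters[of w X] unfolding fp_proj_def
  by (subst filter_True) (auto simp: foldr_fp_cons_Nil letters_def)

text \<open>In the glued form a multiplication only changes the leading group element, which the
  projection either keeps as a letter or deletes.\<close>

lemma fp_proj_fp_cons:
  assumes "X \<subseteq> I" "Y \<subseteq> I" "i \<in> Y" "g \<in> carrier (G i)" "w \<in> words Y"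
  shows "fp_proj G X (fp_cons G (i, g) w)
    = (if i \<in> X then fp_cons G (i, g) (fp_proj G X w) else fp_proj G X w)"
proof -
  have i: "i \<in> I" using assms by auto
  interpret group "G i" by (rule group_G) fact
  obtain k t where *: "k \<in> carrier (G i)" "t \<in> words Y" "t = [] \<or> fst (hd t) \<noteq> i"
    "w = fp_glue G i k t" using words_split[OF assms(5,2) i] by blast
  have glue: "fp_proj G X (fp_glue G i k t)
    = (if i \<in> X then fp_cons G (i, k) (fp_proj G X t) else fp_proj G X t)" for k t
    by (simp add: fp_glue_def fp_proj_def fp_cons_one)
  have "fp_proj G X t \<in> words X" using assms * by (intro fp_proj_in_words)
  then show ?thesis using assms * i
    by (simp add: fp_cons_glue glue fp_cons_fp_cons[where X = X])
qed

lemma fp_proj_foldr: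
  assumes "X \<subseteq> I" "Y \<subseteq> I" "set v \<subseteq> letters Y" "w \<in> words Y"
  shows "fp_proj G X (foldr (fp_cons G) v w) = foldr (fp_cons G) (filter (\<lambda>a. fst a \<in> X) v) (fp_proj G X w)"
  using assms(3)
proof (induction v)
  case (Cons a v)
  have "foldr (fp_cons G) v w \<in> words Y"
    using Cons assms by (intro foldr_fp_cons_in_words) auto
  then show ?case using Cons assms
    by (cases a) (simp add: letters_def fp_proj_fp_cons[where Y = Y])
qed auto

lemma fp_proj_hom:
  assumes "X \<subseteq> I" "Y \<subseteq> I"
  shows "fp_proj G X \<in> hom (free_product G Y) (free_product G X)"
proof (rule homI)
  fix v w assume vw: "v \<in> words Y" "w \<in> words Y"
  have "foldr (fp_cons G) (fp_proj G X v) (fp_proj G X w)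
    = foldr (fp_cons G) (filter (\<lambda>a. fst a \<in> X) v) (fp_proj G X w)"
    unfolding fp_proj_def[of G X v] using words_letters[OF vw(1)]
    by (subst foldr_fp_cons_foldr[OF assms(1)])
       (auto simp: letters_def intro!: words_Nil fp_proj_in_words[OF assms(1) vw(2)])
  then show "fp_proj G X (v \<otimes>\<^bsub>free_product G Y\<^esub> w)
    = fp_proj G X v \<otimes>\<^bsub>free_product G X\<^esub> fp_proj G X w"
    by (simp add: mult_free_product fp_proj_foldr[OF assms words_letters[OF vw(1)] vw(2)])
qed (rule fp_proj_in_words[OF assms(1)])

text \<open>By \<open>fp_proj_foldr\<close> the intermediate reduction may be postponed, and then
  the two filters compose.\<close>

lemma fp_proj_fp_proj:
  assumes "X \<subseteq> I" "Y \<subseteq> I" "w \<in> words Z" "Z \<subseteq> I"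
  shows "fp_proj G X (fp_proj G Y w) = fp_proj G (X \<inter> Y) w"
proof -
  have "fp_proj G X (fp_proj G Y w)
      = foldr (fp_cons G) (filter (\<lambda>a. fst a \<in> X) (filter (\<lambda>a. fst a \<in> Y) w)) (fp_proj G X [])"
    unfolding fp_proj_def[of G Y] using words_letters[OF assms(3)]
    by (intro fp_proj_foldr[OF assms(1,2)] words_Nil) (auto simp: letters_def)
  also have "\<dots> = fp_proj G (X \<inter> Y) w"
    by (simp add: fp_proj_def conj_commute)
  finally show ?thesis .
qed

subsection \<open>The unrestricted free product\<close>

abbreviation ufp :: "('i set \<Rightarrow> ('i \<times> 'g) list) monoid" where
  "ufp \<equiv> unrestricted_free_product G I"

abbreviation pr :: "'i set \<Rightarrow> ('i set \<Rightarrow> ('i \<times> 'g) list) \<Rightarrow> 'i set \<Rightarrow> ('i \<times> 'g) list" where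
  "pr \<equiv> ufp_proj I"

lemma finite_subsets_subset: "X \<in> finite_subsets I \<Longrightarrow> X \<subseteq> I"
  by (simp add: finite_subsets_def)

lemma finite_subsets_Int: "X \<in> finite_subsets I \<Longrightarrow> X \<inter> S \<in> finite_subsets I"
  by (auto simp: finite_subsets_def)

lemma carrier_ufp:
  "x \<in> carrier ufp \<longleftrightarrow> x \<in> extensional (finite_subsets I) \<and> (\<forall>X\<in>finite_subsets I. x X \<in> words X)
     \<and> (\<forall>X\<in>finite_subsets I. \<forall>Y\<in>finite_subsets I. X \<subseteq> Y \<longrightarrow> fp_proj G X (x Y) = x X)"
  by (auto simp: unrestricted_free_product_def PiE_iff)

lemma ufp_in_words: "x \<in> carrier ufp \<Longrightarrow> X \<in> finite_subsets I \<Longrightarrow> x X \<in> words X"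
  by (simp add: carrier_ufp)

lemma ufp_compat:
  "x \<in> carrier ufp \<Longrightarrow> X \<in> finite_subsets I \<Longrightarrow> Y \<in> finite_subsets I \<Longrightarrow> X \<subseteq> Y
     \<Longrightarrow> fp_proj G X (x Y) = x X"
  by (simp add: carrier_ufp)

lemma ufp_eqI:
  assumes "x \<in> carrier ufp" "y \<in> carrier ufp" "\<And>X. X \<in> finite_subsets I \<Longrightarrow> x X = y X"
  shows "x = y"
  using assms by (auto simp: carrier_ufp intro: extensionalityI)

lemma mult_ufp: "X \<in> finite_subsets I \<Longrightarrow> (x \<otimes>\<^bsub>ufp\<^esub> y) X = x X \<otimes>\<^bsub>free_product G X\<^esub> y X"
  and one_ufp: "X \<in> finite_subsets I \<Longrightarrow> \<one>\<^bsub>ufp\<^esub> X = []"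
  by (simp_all add: unrestricted_free_product_def one_free_product)

text \<open>The compatible families form a subgroup of the full product because the projections are
  homomorphisms.\<close>

lemma group_ufp: "group ufp"
proof -
  let ?P = "product_group (finite_subsets I) (free_product G)"
  have fp: "group (free_product G X)" if "X \<in> finite_subsets I" for X
    using that by (intro group_free_product finite_subsets_subset)
  interpret P: group ?P by (intro product_group fp)
  have hom: "group_hom (free_product G Y) (free_product G X) (fp_proj G X)"
    if "X \<in> finite_subsets I" "Y \<in> finite_subsets I" for X Y
    using that by (intro group_hom.intro group_hom_axioms.intro fp fp_proj_hom finite_subsets_subset)
  have "subgroup (carrier ufp) ?P"
  proof (rule P.subgroupI)
    show "carrier ufp \<subseteq> carrier ?P"
      by (auto simp: unrestricted_free_product_def)
    have "\<one>\<^bsub>?P\<^esub> \<in> carrier ufp"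
      by (auto simp: carrier_ufp one_free_product words_Nil fp_proj_def)
    then show "carrier ufp \<noteq> {}" by blast
    show "inv\<^bsub>?P\<^esub> x \<in> carrier ufp" if x: "x \<in> carrier ufp" for x
    proof -
      have inv: "inv\<^bsub>?P\<^esub> x = (\<lambda>X\<in>finite_subsets I. inv\<^bsub>free_product G X\<^esub> x X)"
        using x fp by (intro inv_product_group) (auto simp: carrier_ufp PiE_iff)
      have "inv\<^bsub>free_product G X\<^esub> x X \<in> words X" if "X \<in> finite_subsets I" for X
        using that by (intro group.inv_closed fp ufp_in_words[OF x])
      moreover have "fp_proj G X (inv\<^bsub>free_product G Y\<^esub> x Y) = inv\<^bsub>free_product G X\<^esub> x X"
        if "X \<in> finite_subsets I" "Y \<in> finite_subsets I" "X \<subseteq> Y" for X Y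
        using group_hom.hom_inv[OF hom[OF that(1,2)] ufp_in_words[OF x that(2)]] ufp_compat[OF x that]
        by simp
      ultimately show ?thesis unfolding inv by (simp add: carrier_ufp)
    qed
    show "x \<otimes>\<^bsub>?P\<^esub> y \<in> carrier ufp" if x: "x \<in> carrier ufp" and y: "y \<in> carrier ufp" for x y
    proof -
      have "x X \<otimes>\<^bsub>free_product G X\<^esub> y X \<in> words X" if "X \<in> finite_subsets I" for X
        using that x y by (intro monoid.m_closed group.is_monoid fp ufp_in_words)
      moreover have "fp_proj G X (x Y \<otimes>\<^bsub>free_product G Y\<^esub> y Y) = x X \<otimes>\<^bsub>free_product G X\<^esub> y X"
        if "X \<in> finite_subsets I" "Y \<in> finite_subsets I" "X \<subseteq> Y" for X Y
        using group_hom.hom_mult[OF hom[OF that(1,2)] ufp_in_words[OF x that(2)] ufp_in_words[OF y that(2)]]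
          ufp_compat[OF x that] ufp_compat[OF y that] by simp
      ultimately show ?thesis by (simp add: carrier_ufp)
    qed
  qed
  then have "group (?P\<lparr>carrier := carrier ufp\<rparr>)"
    by (rule subgroup.subgroup_is_group) (rule P.is_group)
  then show ?thesis by (simp add: unrestricted_free_product_def)
qed

sublocale ufp: group ufp
  by (rule group_ufp)

lemma coordinate_hom:
  assumes "X \<in> finite_subsets I"
  shows "group_hom ufp (free_product G X) (\<lambda>x. x X)"
proof -
  have "(\<lambda>x. x X) \<in> hom ufp (free_product G X)"
    by (rule homI) (use assms in \<open>auto simp: mult_ufp ufp_in_words\<close>)
  then show ?thesis using assms
    by (intro group_hom.intro group_hom_axioms.intro group_ufp group_free_product finite_subsets_subset)
qed

section \<open>Projections of the inverse limit\<close>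

lemma ufp_proj_apply: "X \<in> finite_subsets I \<Longrightarrow> pr S x X = x (X \<inter> S)"
  by (simp add: ufp_proj_def)

lemma ufp_proj_closed:
  assumes x: "x \<in> carrier ufp"
  shows "pr S x \<in> carrier ufp"
  unfolding carrier_ufp
proof (intro conjI ballI impI)
  fix X assume X: "X \<in> finite_subsets I"
  show "pr S x X \<in> words X"
    using ufp_in_words[OF x finite_subsets_Int[OF X]] words_mono[of "X \<inter> S" X] X
    by (auto simp: ufp_proj_apply)
  fix Y assume Y: "Y \<in> finite_subsets I" and "X \<subseteq> Y"
  have w: "x (Y \<inter> S) \<in> words (Y \<inter> S)"
    using x Y by (intro ufp_in_words finite_subsets_Int)
  have "fp_proj G X (x (Y \<inter> S)) = fp_proj G X (fp_proj G (Y \<inter> S) (x (Y \<inter> S)))"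
    using fp_proj_eq_self[OF w order_refl] by simp
  also have "\<dots> = fp_proj G (X \<inter> (Y \<inter> S)) (x (Y \<inter> S))"
    using X Y w by (intro fp_proj_fp_proj[where Z = "Y \<inter> S"]) (auto simp: finite_subsets_def)
  also have "X \<inter> (Y \<inter> S) = X \<inter> S" using \<open>X \<subseteq> Y\<close> by blast
  also have "fp_proj G (X \<inter> S) (x (Y \<inter> S)) = x (X \<inter> S)"
    using \<open>X \<subseteq> Y\<close> by (intro ufp_compat[OF x] finite_subsets_Int X Y) auto
  finally show "fp_proj G X (pr S x Y) = pr S x X"
    using X Y by (simp add: ufp_proj_apply)
qed (simp add: ufp_proj_def)

lemma ufp_proj_ufp_proj: "pr S (pr T x) = pr (S \<inter> T) x"
  unfolding ufp_proj_def
  by (rule restrict_ext) (simp add: finite_subsets_Int Int_assoc)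

lemma ufp_proj_self: "x \<in> carrier ufp \<Longrightarrow> pr I x = x"
  by (intro ufp_eqI ufp_proj_closed)
     (simp_all add: ufp_proj_apply Int_absorb2 finite_subsets_subset)

section \<open>Null sequences and homomorphisms to free groups\<close>

definition null_sequence :: "(nat \<Rightarrow> 'i set \<Rightarrow> ('i \<times> 'g) list) \<Rightarrow> bool" where
  "null_sequence x \<longleftrightarrow> (\<forall>n. x n \<in> carrier ufp)
     \<and> (\<forall>X\<in>finite_subsets I. eventually (\<lambda>n. x n X = []) sequentially)"

text \<open>
  The solution is the infinite nested product
  \<open>x n (x (n+1) (x (n+2) \<cdots>)\<^bsup>r (n+1)\<^esup>)\<^bsup>r n\<^esup>\<close>, which is a finite product in every coordinate.
\<close>

lemma null_sequence_equations_solvable: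
  assumes "null_sequence x"
  shows "\<exists>y. \<forall>n. y n \<in> carrier ufp \<and> y n = x n \<otimes>\<^bsub>ufp\<^esub> y (Suc n) [^]\<^bsub>ufp\<^esub> (r n :: nat)"
proof -
  have x: "x n \<in> carrier ufp" for n using assms by (simp add: null_sequence_def)
  obtain N where N: "\<And>X n. X \<in> finite_subsets I \<Longrightarrow> N X \<le> n \<Longrightarrow> x n X = []"
    using assms unfolding null_sequence_def eventually_sequentially by metis
  \<comment> \<open>\<open>z k n\<close> is the nested product starting at \<open>x n\<close>, cut
    off after \<open>k\<close> factors.\<close>
  define z where "z = rec_nat (\<lambda>n. \<one>\<^bsub>ufp\<^esub>) (\<lambda>k zk n. x n \<otimes>\<^bsub>ufp\<^esub> zk (Suc n) [^]\<^bsub>ufp\<^esub> r n)"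
  have z0: "z 0 n = \<one>\<^bsub>ufp\<^esub>"
    and zSuc: "z (Suc k) n = x n \<otimes>\<^bsub>ufp\<^esub> z k (Suc n) [^]\<^bsub>ufp\<^esub> r n" for k n
    by (simp_all add: z_def)
  have z: "z k n \<in> carrier ufp" for k n
    by (induction k arbitrary: n) (simp_all add: z0 zSuc x)
  have coord: "(x n \<otimes>\<^bsub>ufp\<^esub> a [^]\<^bsub>ufp\<^esub> r n) X = x n X \<otimes>\<^bsub>free_product G X\<^esub> a X [^]\<^bsub>free_product G X\<^esub> r n"
    if "X \<in> finite_subsets I" "a \<in> carrier ufp" for a n X
    using that group_hom.hom_nat_pow[OF coordinate_hom[OF that(1)] that(2)] by (simp add: mult_ufp)
  \<comment> \<open>Going one level deeper inserts only \<open>x (n + k)\<close>, whose coordinate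
    at \<open>X\<close> is trivial once \<open>N X \<le> n + k\<close>.\<close>
  have step: "z (Suc k) n X = z k n X" if X: "X \<in> finite_subsets I" and "N X \<le> n + k" for k n X
    using that(2)
  proof (induction k arbitrary: n)
    case 0
    then show ?case using X N by (simp add: z0 zSuc one_ufp x)
  next
    case (Suc k)
    have "z (Suc (Suc k)) n X
        = x n X \<otimes>\<^bsub>free_product G X\<^esub> z (Suc k) (Suc n) X [^]\<^bsub>free_product G X\<^esub> r n"
      by (subst zSuc) (rule coord[OF X z])
    also have "\<dots> = x n X \<otimes>\<^bsub>free_product G X\<^esub> z k (Suc n) X [^]\<^bsub>free_product G X\<^esub> r n"
      using Suc by simp
    also have "\<dots> = z (Suc k) n X"
      by (subst zSuc) (rule coord[OF X z, symmetric])
    finally show ?case .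
  qed
  have stable: "z k n X = z (N X) n X" if X: "X \<in> finite_subsets I" and "N X \<le> k" for k n X
    using that(2) by (induction k rule: dec_induct) (simp_all add: step X)
  \<comment> \<open>Depth \<open>N X\<close> suffices at \<open>X\<close> for every starting index
    \<open>n\<close>. Compatibility of two coordinates is checked at a common depth.\<close>
  define y where "y n = (\<lambda>X\<in>finite_subsets I. z (N X) n X)" for n
  have y_eq: "y n X = z k n X" if "X \<in> finite_subsets I" "N X \<le> k" for n k X
    using that stable[OF that, of n] by (simp add: y_def)
  have y: "y n \<in> carrier ufp" for n
    unfolding carrier_ufp
  proof (intro conjI ballI impI)
    fix X Y assume XY: "X \<in> finite_subsets I" "Y \<in> finite_subsets I" "X \<subseteq> Y"
    show "fp_proj G X (y n Y) = y n X"
      using ufp_compat[OF z XY, of "max (N X) (N Y)" n] XY by (simp add: y_eq[of _ "max (N X) (N Y)"])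
  next
    show "y n X \<in> words X" if "X \<in> finite_subsets I" for X
      using that z by (simp add: y_def ufp_in_words)
  qed (simp add: y_def)
  have "y n = x n \<otimes>\<^bsub>ufp\<^esub> y (Suc n) [^]\<^bsub>ufp\<^esub> r n" for n
  proof (rule ufp_eqI)
    fix X assume X: "X \<in> finite_subsets I"
    \<comment> \<open>One extra level of depth lets the recursion unfold once and leave depth
      \<open>N X\<close> for \<open>y (Suc n)\<close>.\<close>
    have "y n X = z (Suc (N X)) n X" using X by (simp add: y_eq[of _ "Suc (N X)"])
    also have "\<dots> = x n X \<otimes>\<^bsub>free_product G X\<^esub> z (N X) (Suc n) X [^]\<^bsub>free_product G X\<^esub> r n"
      by (subst zSuc) (rule coord[OF X z])
    also have "\<dots> = (x n \<otimes>\<^bsub>ufp\<^esub> y (Suc n) [^]\<^bsub>ufp\<^esub> r n) X"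
      using X by (simp add: coord[OF X y] y_eq[of _ "N X"])
    finally show "y n X = (x n \<otimes>\<^bsub>ufp\<^esub> y (Suc n) [^]\<^bsub>ufp\<^esub> r n) X" .
  qed (use x y in auto)
  with y show ?thesis by blast
qed

text \<open>Exponents \<open>r\<close> are first chosen so that the system for the images
  \<open>h (x n)\<close> is unsolvable; a solution of the system for \<open>x\<close> with these
  exponents is then mapped by \<open>h\<close> to a forbidden one.\<close>

lemma null_sequence_meets_kernel:
  assumes F: "free_group F" and h: "h \<in> hom ufp F" and x: "null_sequence x"
  shows "\<exists>n. h (x n) = \<one>\<^bsub>F\<^esub>"
proof (rule ccontr)
  assume neq: "\<nexists>n. h (x n) = \<one>\<^bsub>F\<^esub>"
  obtain B where "group F" "free_basis F B" using F unfolding free_group_def by blast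
  then interpret F: free_group_basis F B
    by (intro free_group_basis.intro free_group_basis_axioms.intro)
  interpret h: group_hom ufp F h
    by (intro group_hom.intro group_hom_axioms.intro group_ufp F.is_group h)
  have x': "x n \<in> carrier ufp" for n using x by (simp add: null_sequence_def)
  obtain r where r: "\<And>y. \<not> (\<forall>n. y n \<in> carrier F \<and> y n = h (x n) \<otimes>\<^bsub>F\<^esub> y (Suc n) [^]\<^bsub>F\<^esub> (r n :: nat))"
    using F.ex_unsolvable_exponents[of "\<lambda>n. h (x n)"] neq x' by auto
  obtain y where y: "\<And>n. y n \<in> carrier ufp" "\<And>n. y n = x n \<otimes>\<^bsub>ufp\<^esub> y (Suc n) [^]\<^bsub>ufp\<^esub> r n"
    using null_sequence_equations_solvable[OF x, of r] by blast
  have "h (y n) = h (x n) \<otimes>\<^bsub>F\<^esub> h (y (Suc n)) [^]\<^bsub>F\<^esub> r n" for n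
    using y(2)[of n] y(1) x' by (metis h.hom_mult h.hom_nat_pow ufp.nat_pow_closed)
  with y(1) have "\<forall>n. h (y n) \<in> carrier F \<and> h (y n) = h (x n) \<otimes>\<^bsub>F\<^esub> h (y (Suc n)) [^]\<^bsub>F\<^esub> r n"
    using h.hom_closed by blast
  with r[of "\<lambda>n. h (y n)"] show False by (rule notE)
qed

text \<open>The quotients of \<open>x n\<close> by \<open>y n\<close> form a null sequence, so
  \<open>h\<close> kills one of them.\<close>

lemma hom_eq_along_null_sequence:
  assumes F: "free_group F" and h: "h \<in> hom ufp F"
    and xy: "\<And>n. x n \<in> carrier ufp" "\<And>n. y n \<in> carrier ufp"
    and ev: "\<And>X. X \<in> finite_subsets I \<Longrightarrow> eventually (\<lambda>n. x n X = y n X) sequentially"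
  shows "\<exists>n. h (x n) = h (y n)"
proof -
  interpret F: group F using F by (simp add: free_group_def)
  interpret h: group_hom ufp F h
    by (intro group_hom.intro group_hom_axioms.intro group_ufp F.is_group h)
  have "null_sequence (\<lambda>n. x n \<otimes>\<^bsub>ufp\<^esub> inv\<^bsub>ufp\<^esub> y n)"
    unfolding null_sequence_def
  proof (intro conjI ballI allI)
    fix X assume X: "X \<in> finite_subsets I"
    interpret X: group_hom ufp "free_product G X" "\<lambda>x. x X" by (rule coordinate_hom[OF X])
    show "eventually (\<lambda>n. (x n \<otimes>\<^bsub>ufp\<^esub> inv\<^bsub>ufp\<^esub> y n) X = []) sequentially"
      using ev[OF X]
    proof eventually_elim
      case (elim n)
      then show ?case
        using X.hom_mult[of "x n" "inv\<^bsub>ufp\<^esub> y n"] X.hom_inv[of "y n"] X.H.r_inv[of "y n X"]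
          X.hom_closed[of "y n"] xy by (simp add: one_free_product)
    qed
  qed (use xy in auto)
  then obtain n where "h (x n \<otimes>\<^bsub>ufp\<^esub> inv\<^bsub>ufp\<^esub> y n) = \<one>\<^bsub>F\<^esub>"
    using null_sequence_meets_kernel[OF F h] by blast
  then have "h (x n) \<otimes>\<^bsub>F\<^esub> inv\<^bsub>F\<^esub> h (y n) = \<one>\<^bsub>F\<^esub>" using xy by simp
  then have "h (x n) = h (y n)" using xy by (metis F.inv_equality F.inv_inv F.inv_closed h.hom_closed)
  then show ?thesis by blast
qed

section \<open>The filter of supporting sets\<close>

definition supports :: "(('i set \<Rightarrow> ('i \<times> 'g) list) \<Rightarrow> 'f) \<Rightarrow> 'i set set" where
  "supports h = {S. S \<subseteq> I \<and> (\<forall>x\<in>carrier ufp. h x = h (pr S x))}"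

lemma supports_Int:
  assumes "A \<in> supports h" "B \<in> supports h"
  shows "A \<inter> B \<in> supports h"
proof -
  have "h x = h (pr (A \<inter> B) x)" if "x \<in> carrier ufp" for x
    using assms that ufp_proj_closed[OF that, of B] unfolding supports_def
    by (auto simp flip: ufp_proj_ufp_proj)
  then show ?thesis using assms by (auto simp: supports_def)
qed

text \<open>Since \<open>pr A\<close> absorbs \<open>pr B\<close>, both \<open>h (pr B x)\<close>
  and \<open>h x\<close> equal \<open>h (pr A x)\<close>.\<close>

lemma supports_mono:
  assumes "A \<in> supports h" "A \<subseteq> B" "B \<subseteq> I"
  shows "B \<in> supports h"
proof -
  have "h x = h (pr B x)" if "x \<in> carrier ufp" for x
  proof -
    have "h (pr B x) = h (pr A (pr B x))"
      using assms(1) ufp_proj_closed[OF that] unfolding supports_def by blast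
    also have "\<dots> = h (pr A x)" using assms(2) by (simp add: ufp_proj_ufp_proj Int_absorb2)
    finally show ?thesis using assms(1) that unfolding supports_def by simp
  qed
  then show ?thesis using assms by (simp add: supports_def)
qed

lemma countably_complete_supports:
  assumes F: "free_group F" and h: "h \<in> hom ufp F"
  shows "countably_complete (supports h)"
  unfolding countably_complete_def
proof (intro allI impI, elim conjE)
  fix \<A> assume \<A>: "\<A> \<subseteq> supports h" "\<A> \<noteq> {}" "countable \<A>"
  \<comment> \<open>The enumeration may repeat members, so finite families are included.\<close>
  define A where "A = from_nat_into \<A>"
  have range: "range A = \<A>" using \<A> by (simp add: A_def)
  define B where "B n = (\<Inter>k\<le>n. A k)" for n
  have B: "B n \<in> supports h" for n
  proof (induction n)
    case 0
    then show ?case using range \<A> by (auto simp: B_def)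
  next
    case (Suc n)
    have "B (Suc n) = B n \<inter> A (Suc n)" by (auto simp: B_def le_Suc_eq)
    moreover have "A (Suc n) \<in> supports h" using range \<A> by blast
    ultimately show ?case using supports_Int[OF Suc] by simp
  qed
  let ?S = "\<Inter>\<A>"
  have "h x = h (pr ?S x)" if x: "x \<in> carrier ufp" for x
  proof -
    have "\<exists>n::nat. h (pr (B n) x) = h (pr ?S x)"
    proof (rule hom_eq_along_null_sequence[OF F h])
      fix X assume X: "X \<in> finite_subsets I"
      \<comment> \<open>Membership stabilises at each single index, hence simultaneously on the
        finite set \<open>X\<close>; from then on the two projections agree at
        \<open>X\<close>.\<close>
      have "eventually (\<lambda>n. i \<in> B n \<longleftrightarrow> i \<in> ?S) sequentially" for i
      proof (cases "i \<in> ?S")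
        case True
        then show ?thesis using range by (auto simp: B_def)
      next
        case False
        then obtain k where "i \<notin> A k" using range by auto
        then have "i \<notin> B n" if "k \<le> n" for n using that by (auto simp: B_def)
        then show ?thesis using False eventually_sequentially by blast
      qed
      then have "eventually (\<lambda>n. \<forall>i\<in>X. i \<in> B n \<longleftrightarrow> i \<in> ?S) sequentially"
        using X by (intro eventually_ball_finite) (auto simp: finite_subsets_def)
      then show "eventually (\<lambda>n. pr (B n) x X = pr ?S x X) sequentially"
      proof eventually_elim
        case (elim n)
        then have "X \<inter> B n = X \<inter> ?S" by blast
        then show ?case using X by (simp only: ufp_proj_apply)
      qed
    qed (intro ufp_proj_closed x)+
    then show ?thesis using B x by (auto simp: supports_def)
  qed
  moreover have "?S \<subseteq> I" using \<A> by (auto simp: supports_def)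
  ultimately show "?S \<in> supports h" by (simp add: supports_def)
qed

lemma supports_disjoint_sequence:
  fixes A :: "nat \<Rightarrow> 'i set"
  assumes F: "free_group F" and h: "h \<in> hom ufp F"
    and disj: "\<And>m n. m < n \<Longrightarrow> A m \<inter> A n = {}"
  shows "\<exists>n. I - A n \<in> supports h"
proof (rule ccontr)
  assume "\<nexists>n. I - A n \<in> supports h"
  then have "\<forall>n. \<exists>x\<in>carrier ufp. h x \<noteq> h (pr (I - A n) x)" by (auto simp: supports_def)
  then obtain x where x: "\<And>n. x n \<in> carrier ufp" "\<And>n. h (x n) \<noteq> h (pr (I - A n) (x n))"
    by metis
  have "\<exists>n. h (x n) = h (pr (I - A n) (x n))"
  proof (rule hom_eq_along_null_sequence[OF F h])
    fix X assume X: "X \<in> finite_subsets I"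
    \<comment> \<open>By disjointness each index lies in at most one \<open>A k\<close>, so deleting
      \<open>A n\<close> eventually leaves the coordinate at \<open>X\<close> unchanged.\<close>
    have "eventually (\<lambda>n. i \<notin> A n) sequentially" for i
    proof (cases "\<exists>k. i \<in> A k")
      case True
      then obtain k where "i \<in> A k" by blast
      then have "i \<notin> A n" if "Suc k \<le> n" for n using disj[of k n] that by auto
      then show ?thesis using eventually_sequentially by blast
    qed auto
    then have "eventually (\<lambda>n. \<forall>i\<in>X. i \<notin> A n) sequentially"
      using X by (intro eventually_ball_finite) (auto simp: finite_subsets_def)
    then show "eventually (\<lambda>n. x n X = pr (I - A n) (x n) X) sequentially"
    proof eventually_elim
      case (elim n)
      then have "X \<inter> (I - A n) = X" using X by (auto simp: finite_subsets_def)
      then show ?case using X by (simp only: ufp_proj_apply)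
    qed
  qed (intro ufp_proj_closed x)+
  with x(2) show False by blast
qed

lemma supports_contain_finite_Inter_ultrafilters:
  assumes "free_group F" "h \<in> hom ufp F"
  shows "\<exists>\<U>. finite \<U> \<and> (\<forall>u\<in>\<U>. ultrafilter_on I u \<and> countably_complete u)
    \<and> (\<forall>S\<subseteq>I. (\<forall>u\<in>\<U>. S \<in> u) \<longrightarrow> S \<in> supports h)"
proof (rule filter_contains_finite_Inter_ultrafilters)
  show "I \<in> supports h" by (simp add: supports_def ufp_proj_self)
  show "\<exists>n. I - A n \<in> supports h" if "\<And>m n. m < n \<Longrightarrow> A m \<inter> A n = {}" for A :: "nat \<Rightarrow> 'i set"
    using that by (rule supports_disjoint_sequence[OF assms])
qed (fact supports_mono supports_Int countably_complete_supports[OF assms])+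

section \<open>Embedding free products into the inverse limit\<close>

text \<open>For finite \<open>X0\<close> this lets \<open>h\<close> act on the free product over
  \<open>X0\<close>; composing with it yields the factor map in the second claim.\<close>

definition fp_embed :: "'i set \<Rightarrow> ('i \<times> 'g) list \<Rightarrow> 'i set \<Rightarrow> ('i \<times> 'g) list" where
  "fp_embed X0 w = (\<lambda>X\<in>finite_subsets I. fp_proj G (X \<inter> X0) w)"

lemma fp_embed_hom:
  assumes "X0 \<subseteq> I"
  shows "fp_embed X0 \<in> hom (free_product G X0) ufp"
proof -
  have closed: "fp_embed X0 w \<in> carrier ufp" if w: "w \<in> words X0" for w
    unfolding carrier_ufp
  proof (intro conjI ballI impI)
    fix X assume X: "X \<in> finite_subsets I"
    have XI: "X \<subseteq> I" "X \<inter> X0 \<subseteq> I" using X by (auto simp: finite_subsets_def)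
    show "fp_embed X0 w X \<in> words X"
      using fp_proj_in_words[OF XI(2) w] words_mono[of "X \<inter> X0" X] X by (auto simp: fp_embed_def)
    fix Y assume Y: "Y \<in> finite_subsets I" and "X \<subseteq> Y"
    have "Y \<inter> X0 \<subseteq> I" using assms by blast
    then have "fp_proj G X (fp_proj G (Y \<inter> X0) w) = fp_proj G (X \<inter> (Y \<inter> X0)) w"
      using fp_proj_fp_proj[OF XI(1) _ w assms] by blast
    moreover have "X \<inter> (Y \<inter> X0) = X \<inter> X0" using \<open>X \<subseteq> Y\<close> by blast
    ultimately show "fp_proj G X (fp_embed X0 w Y) = fp_embed X0 w X"
      using X Y by (simp add: fp_embed_def)
  qed (simp add: fp_embed_def)
  show ?thesis
  proof (rule homI)
    fix v w assume vw: "v \<in> words X0" "w \<in> words X0"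
    have vw': "v \<otimes>\<^bsub>free_product G X0\<^esub> w \<in> words X0"
      using vw assms by (intro monoid.m_closed group.is_monoid group_free_product)
    show "fp_embed X0 (v \<otimes>\<^bsub>free_product G X0\<^esub> w) = fp_embed X0 v \<otimes>\<^bsub>ufp\<^esub> fp_embed X0 w"
    proof (rule ufp_eqI)
      fix X assume X: "X \<in> finite_subsets I"
      have "X \<inter> X0 \<subseteq> I" using assms by blast
      from hom_mult[OF fp_proj_hom[OF this assms] vw] X
      show "fp_embed X0 (v \<otimes>\<^bsub>free_product G X0\<^esub> w) X = (fp_embed X0 v \<otimes>\<^bsub>ufp\<^esub> fp_embed X0 w) X"
        by (simp add: mult_ufp fp_embed_def mult_free_product)
    qed (use closed vw vw' in auto)
  qed (rule closed)
qed

text \<open>By compatibility \<open>x (X \<inter> X0)\<close> is a projection of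
  \<open>x X0\<close>, so \<open>pr X0 x\<close> depends on that one coordinate only.\<close>

lemma ufp_proj_eq_fp_embed:
  assumes "x \<in> carrier ufp" "X0 \<in> finite_subsets I"
  shows "pr X0 x = fp_embed X0 (x X0)"
  unfolding ufp_proj_def fp_embed_def
  using assms by (intro restrict_ext) (simp add: ufp_compat finite_subsets_Int)

section \<open>Ultrafilters and finite supports of homomorphisms\<close>

lemma hom_ufp_ultrafilters:
  assumes "free_group F" "h \<in> hom ufp F" "I \<noteq> {}"
  shows "\<exists>(m::nat) (u :: nat \<Rightarrow> 'i set set).
     (\<forall>k\<le>m. ultrafilter_on I (u k) \<and> countably_complete (u k)) \<and>
     (\<forall>U. (\<forall>k\<le>m. U k \<in> u k) \<longrightarrow> (\<forall>x \<in> carrier ufp. h x = h (pr (\<Union>k\<le>m. U k) x)))"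
proof -
  obtain \<U> where \<U>: "finite \<U>" "\<forall>u\<in>\<U>. ultrafilter_on I u \<and> countably_complete u"
    "\<forall>S\<subseteq>I. (\<forall>u\<in>\<U>. S \<in> u) \<longrightarrow> S \<in> supports h"
    using supports_contain_finite_Inter_ultrafilters[OF assms(1,2)] by blast
  obtain i where i: "i \<in> I" using assms by blast
  \<comment> \<open>The list of ultrafilters must have at least one entry, whereas
    \<open>\<U>\<close> may be empty. A principal ultrafilter is added; this only strengthens the
    condition on the sets \<open>U k\<close>.\<close>
  define \<V> where "\<V> = insert {A. A \<subseteq> I \<and> i \<in> A} \<U>"
  have "finite \<V>" using \<U> by (simp add: \<V>_def)
  then obtain u where "bij_betw u {0..<card \<V>} \<V>" using ex_bij_betw_nat_finite by blast
  moreover have "card \<V> > 0" using \<open>finite \<V>\<close> unfolding card_gt_0_iff by (simp add: \<V>_def)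
  then have "{0..<card \<V>} = {..card \<V> - 1}" by auto
  ultimately have u: "u ` {..card \<V> - 1} = \<V>" by (simp add: bij_betw_def)
  have uf: "ultrafilter_on I (u k) \<and> countably_complete (u k)" if "k \<le> card \<V> - 1" for k
  proof -
    have "u k \<in> \<V>" using u that by blast
    then have "u k = {A. A \<subseteq> I \<and> i \<in> A} \<or> u k \<in> \<U>" by (simp add: \<V>_def)
    then show ?thesis
    proof
      assume "u k = {A. A \<subseteq> I \<and> i \<in> A}"
      then show ?thesis by (simp only: principal_ultrafilter[OF i] simp_thms)
    qed (use \<U>(2) in simp)
  qed
  have "(\<Union>k\<le>card \<V> - 1. U k) \<in> supports h" if U: "\<And>k. k \<le> card \<V> - 1 \<Longrightarrow> U k \<in> u k" for U
  proof -
    let ?S = "\<Union>k\<le>card \<V> - 1. U k"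
    have "U k \<subseteq> I" if "k \<le> card \<V> - 1" for k
      using uf[OF that] U[OF that] ultrafilter_onD(3) by blast
    then have S: "?S \<subseteq> I" by blast
    \<comment> \<open>Each \<open>v\<close> in \<open>\<U>\<close> is some \<open>u k\<close>, and
      the union contains the corresponding \<open>U k\<close>.\<close>
    have "?S \<in> v" if "v \<in> \<U>" for v
    proof -
      obtain k where k: "k \<le> card \<V> - 1" "v = u k" using \<open>v \<in> \<U>\<close> u unfolding \<V>_def by blast
      then have "ultrafilter_on I v" "U k \<in> v" "U k \<subseteq> ?S" using uf U by auto
      then show ?thesis using S by (rule ultrafilter_onD(4))
    qed
    then show ?thesis using \<U>(3) S by blast
  qed
  then show ?thesis using uf
    by (intro exI[of _ "card \<V> - 1"] exI[of _ u]) (auto simp: supports_def)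
qed

lemma hom_ufp_finite_support:
  assumes F: "free_group F" "h \<in> hom ufp F" and below: "below_least_measurable I"
  shows "\<exists>X0 hbar. finite X0 \<and> X0 \<subseteq> I \<and> hbar \<in> hom (free_product G X0) F \<and>
     (\<forall>x \<in> carrier ufp. h x = hbar (x X0))"
proof -
  obtain \<U> where \<U>: "finite \<U>" "\<forall>u\<in>\<U>. ultrafilter_on I u \<and> countably_complete u"
    "\<forall>S\<subseteq>I. (\<forall>u\<in>\<U>. S \<in> u) \<longrightarrow> S \<in> supports h"
    using supports_contain_finite_Inter_ultrafilters[OF F] by blast
  have "\<forall>u\<in>\<U>. \<exists>i\<in>I. u = {A. A \<subseteq> I \<and> i \<in> A}"
    using \<U>(2) countably_complete_imp_principal[OF _ _ below] unfolding principal_on_def by blast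
  then obtain c where c: "\<And>u. u \<in> \<U> \<Longrightarrow> c u \<in> I" "\<And>u. u \<in> \<U> \<Longrightarrow> u = {A. A \<subseteq> I \<and> c u \<in> A}"
    by metis
  \<comment> \<open>The finitely many generating points of the ultrafilters, now principal, form a
    set that belongs to each of them and hence supports \<open>h\<close>.\<close>
  let ?X0 = "c ` \<U>"
  have X0: "?X0 \<in> finite_subsets I" using c(1) \<U>(1) by (auto simp: finite_subsets_def)
  have "?X0 \<in> u" if "u \<in> \<U>" for u
    using c(1) that by (subst c(2)[OF that]) auto
  then have supp: "?X0 \<in> supports h" using \<U>(3) c(1) by blast
  \<comment> \<open>The factor map is \<open>h \<circ> fp_embed ?X0\<close>: as \<open>?X0\<close>
    supports \<open>h\<close>, the value \<open>h x\<close> equals \<open>h\<close> of the embedded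
    coordinate \<open>x ?X0\<close>.\<close>
  have "h x = (h \<circ> fp_embed ?X0) (x ?X0)" if "x \<in> carrier ufp" for x
    using supp that ufp_proj_eq_fp_embed[OF that X0] by (simp add: supports_def)
  moreover have "h \<circ> fp_embed ?X0 \<in> hom (free_product G ?X0) F"
    by (rule hom_compose[OF fp_embed_hom[OF finite_subsets_subset[OF X0]] F(2)])
  moreover have "finite ?X0" "?X0 \<subseteq> I" using X0 by (auto simp: finite_subsets_def)
  ultimately show ?thesis by blast
qed

end

theorem theorem1p1:
  fixes I :: "'i set"
    and G :: "'i \<Rightarrow> ('g, 'm) monoid_scheme"
    and F :: "('f, 'n) monoid_scheme"
  assumes "\<And>i. i \<in> I \<Longrightarrow> group (G i)"
    and "free_group F"
  shows "(I \<noteq> {} \<longrightarrow>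
           (\<forall>h \<in> hom (unrestricted_free_product G I) F.
             \<exists>(m::nat) (u :: nat \<Rightarrow> 'i set set).
               (\<forall>k\<le>m. ultrafilter_on I (u k) \<and> countably_complete (u k)) \<and>
               (\<forall>U. (\<forall>k\<le>m. U k \<in> u k) \<longrightarrow>
                  (\<forall>x \<in> carrier (unrestricted_free_product G I).
                     h x = h (ufp_proj I (\<Union>k\<le>m. U k) x)))))
       \<and> (below_least_measurable I \<longrightarrow>
           (\<forall>h \<in> hom (unrestricted_free_product G I) F.
             \<exists>X0 hbar. finite X0 \<and> X0 \<subseteq> I \<and> hbar \<in> hom (free_product G X0) F \<and>
               (\<forall>x \<in> carrier (unrestricted_free_product G I). h x = hbar (x X0))))"
proof -
  interpret group_family G I by (rule group_family.intro) (rule assms(1))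
  show ?thesis
    by (intro conjI impI ballI hom_ufp_ultrafilters[OF assms(2)] hom_ufp_finite_support[OF assms(2)])
qed

end
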